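(* For every $n\in\mathbb N$ there is a set $S\subset\mathbb C^n$ which is a union of at most countably many hypersurfaces in $\mathbb C^n$, such that for every $\mathbf a=(a_1,\dots,a_n)\in\mathbb C^n\setminus S$ and all $b_1,\dots,b_n,\alpha\in\mathbb C$, all meromorphic solutions $u=u(z)$ (if they exist) of the ordinary differential equation $$[D-(a_nu+b_n)]\cdots[D-(a_2u+b_2)][D-(a_1u+b_1)](u-\alpha)=0,\qquad D=\frac{d}{dz},$$ belong to the class $W$, which consists of elliptic functions and their degenerations. Hence, for any such generic $\mathbf a\in\mathbb C^n$, Hayman's conjecture is true for this equation: for every meromorphic solution $u$ there exist $a,b,c\in\mathbb R^+$ such that $$T(r,u)<a\,\exp_{n-1}(b\,r^c),\qquad 0\le r<\infty.$$
   Context: "Meromorphic" means meromorphic on the whole complex plane $\mathbb C$. $\mathbb N=\{1,2,3,\dots\}$. The operator $[D-g(u)]$ acts on a function $F$ by $[D-g(u)]F=F'-g(u)F$, and the operators are applied successively from right to left, starting from the function $u-\alpha$; thus the equation is an algebraic ODE of order $n$ in $u$ with constant coefficients. The class $W$ consists of elliptic functions and their degenerations, i.e. the meromorphic functions that are elliptic functions, or rational functions of one exponential $e^{kz}$ ($k\in\mathbb C$), or rational functions of $z$. $T(r,f)$ is the Nevanlinna characteristic of $f$. The iterated exponentials are $\exp_0(x)=x$, $\exp_1(x)=e^x$, $\exp_l(x)=\exp\{\exp_{l-1}(x)\}$. Hayman's conjecture for algebraic ODEs: if $f$ is a meromorphic solution of $P(z,f,f',\dots,f^{(n)})=0$, where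 $P$ is a polynomial in all its arguments, then there exist $a,b,c\in\mathbb R^+$ such that $T(r,f)<a\exp_{n-1}(br^c)$ for $0\le r<\infty$.
   Formalization: For n=1 the growth bound is proved for r ≥ R, for every R > 0, with a, b, c allowed to depend on R: on 0 ≤ r < ∞ it is false, since at r=0 the right side is 0 while the constant solution u=α has T(0,u)=log⁺|α| ≥ 0. For n ≥ 2 the bound is proved for all r ≥ 0. *)

theory Defs
  imports "HOL-Complex_Analysis.Complex_Analysis" "HOL-Library.Poly_Mapping"
    "HOL-Library.FuncSet" "HOL-Computational_Algebra.Computational_Algebra"
begin

section \<open>Hypersurfaces in affine space\<close>

text \<open>Points of the n-dimensional complex space are functions on the indices 1, ..., n
  (equal to \<open>undefined\<close> at all other indices).\<close>

definition cspace :: "nat \<Rightarrow> (nat \<Rightarrow> complex) set" where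
  "cspace n = {1..n} \<rightarrow>\<^sub>E UNIV"

text \<open>Polynomials in variables indexed by \<open>nat\<close>: a monomial is a finitely supported
  exponent map, a polynomial a finitely supported map from monomials to coefficients.\<close>

type_synonym cmpoly = "(nat \<Rightarrow>\<^sub>0 nat) \<Rightarrow>\<^sub>0 complex"

definition cmpoly_eval :: "cmpoly \<Rightarrow> (nat \<Rightarrow> complex) \<Rightarrow> complex" where
  "cmpoly_eval P x =
     (\<Sum>m\<in>Poly_Mapping.keys P. Poly_Mapping.lookup P m *
        (\<Prod>i\<in>Poly_Mapping.keys m. x i ^ Poly_Mapping.lookup m i))"

definition cmpoly_vars :: "cmpoly \<Rightarrow> nat set" where
  "cmpoly_vars P = (\<Union>m\<in>Poly_Mapping.keys P. Poly_Mapping.keys m)"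

text \<open>A polynomial is nonconstant iff some variable occurs in it.\<close>

definition hypersurface :: "nat \<Rightarrow> (nat \<Rightarrow> complex) set \<Rightarrow> bool" where
  "hypersurface n H \<longleftrightarrow>
     (\<exists>P. cmpoly_vars P \<subseteq> {1..n} \<and> cmpoly_vars P \<noteq> {} \<and>
          H = {x \<in> cspace n. cmpoly_eval P x = 0})"


section \<open>The differential equation\<close>

text \<open>Meromorphic functions on the plane are represented by functions that are
  \<open>nicely_meromorphic_on UNIV\<close>, i.e. analytic away from their poles and with the
  conventional value 0 at poles.\<close>

definition D_minus :: "(complex \<Rightarrow> complex) \<Rightarrow> (complex \<Rightarrow> complex) \<Rightarrow> complex \<Rightarrow> complex" where
  "D_minus G F = (\<lambda>z. deriv F z - G z * F z)"

primrec factor_product ::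
  "(nat \<Rightarrow> complex) \<Rightarrow> (nat \<Rightarrow> complex) \<Rightarrow> (complex \<Rightarrow> complex) \<Rightarrow> nat
     \<Rightarrow> (complex \<Rightarrow> complex) \<Rightarrow> complex \<Rightarrow> complex" where
  "factor_product a b u 0 F = F"
| "factor_product a b u (Suc k) F =
     D_minus (\<lambda>z. a (Suc k) * u z + b (Suc k)) (factor_product a b u k F)"

text \<open>The equation is required at every point that is not a pole of \<open>u\<close>; since poles are
  isolated, all the functions occurring in it are holomorphic near such a point.\<close>

definition meromorphic_solution ::
  "nat \<Rightarrow> (nat \<Rightarrow> complex) \<Rightarrow> (nat \<Rightarrow> complex) \<Rightarrow> complex \<Rightarrow> (complex \<Rightarrow> complex) \<Rightarrow> bool" where
  "meromorphic_solution n a b \<alpha> u \<longleftrightarrow>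
     u nicely_meromorphic_on UNIV \<and>
     (\<forall>z. \<not> is_pole u z \<longrightarrow> factor_product a b u n (\<lambda>w. u w - \<alpha>) z = 0)"


section \<open>The class W\<close>

definition elliptic :: "(complex \<Rightarrow> complex) \<Rightarrow> bool" where
  "elliptic f \<longleftrightarrow>
     f nicely_meromorphic_on UNIV \<and>
     (\<exists>\<omega>1 \<omega>2. \<omega>1 \<noteq> 0 \<and> \<omega>2 / \<omega>1 \<notin> \<real> \<and> (\<forall>z. f (z + \<omega>1) = f z) \<and> (\<forall>z. f (z + \<omega>2) = f z))"

text \<open>The fractions below are in lowest terms, so the denominator vanishes exactly at the
  poles, where \<open>x / 0 = 0\<close> agrees with the value convention for meromorphic functions.
  The exponent \<open>k = 0\<close> yields only constants.\<close>

definition rational_fun :: "(complex \<Rightarrow> complex) \<Rightarrow> bool" where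
  "rational_fun f \<longleftrightarrow>
     (\<exists>p q :: complex poly. q \<noteq> 0 \<and> coprime p q \<and> (\<forall>z. f z = poly p z / poly q z))"

definition rational_exp_fun :: "(complex \<Rightarrow> complex) \<Rightarrow> bool" where
  "rational_exp_fun f \<longleftrightarrow> (\<exists>R k. rational_fun R \<and> (\<forall>z. f z = R (exp (k * z))))"

definition class_W :: "(complex \<Rightarrow> complex) set" where
  "class_W = {f. elliptic f \<or> rational_exp_fun f \<or> rational_fun f}"


section \<open>Nevanlinna characteristic and Hayman's bound\<close>

text \<open>\<open>log\<^sup>+\<close>; the convention \<open>ln 0 = 0\<close> gives the correct value 0 at 0.\<close>

definition log_plus :: "real \<Rightarrow> real" where
  "log_plus x = max 0 (ln x)"

definition proximity :: "real \<Rightarrow> (complex \<Rightarrow> complex) \<Rightarrow> real" where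
  "proximity r f =
     1 / (2 * pi) * integral {0..2 * pi} (\<lambda>\<theta>. log_plus (norm (f (of_real r * cis \<theta>))))"

definition pole_count :: "real \<Rightarrow> (complex \<Rightarrow> complex) \<Rightarrow> nat" where
  "pole_count r f = (\<Sum>z\<in>{z. norm z \<le> r \<and> is_pole f z}. nat (- zorder f z))"

text \<open>The integrand vanishes for small positive \<open>t\<close>, and also at \<open>t = 0\<close>.\<close>

definition counting :: "real \<Rightarrow> (complex \<Rightarrow> complex) \<Rightarrow> real" where
  "counting r f =
     integral {0..r} (\<lambda>t. (real (pole_count t f) - real (pole_count 0 f)) / t)
       + real (pole_count 0 f) * ln r"

definition nevanlinna_T :: "real \<Rightarrow> (complex \<Rightarrow> complex) \<Rightarrow> real" where
  "nevanlinna_T r f = proximity r f + counting r f"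

definition iter_exp :: "nat \<Rightarrow> real \<Rightarrow> real" where
  "iter_exp l = exp ^^ l"

text \<open>Hayman's bound for order \<open>n\<close> on the range \<open>R \<le> r < \<infinity>\<close>. For \<open>n = 1\<close> the right-hand side
  \<open>a * b * r powr c\<close> tends to 0 as \<open>r\<close> tends to 0, whereas \<open>T(r,u)\<close> is a positive constant for
  a constant \<open>u\<close> with modulus larger than 1; so for \<open>n = 1\<close> the bound is only meaningful
  for \<open>R > 0\<close>.\<close>

definition hayman_bound :: "nat \<Rightarrow> (complex \<Rightarrow> complex) \<Rightarrow> real \<Rightarrow> bool" where
  "hayman_bound n u R \<longleftrightarrow>
     (\<exists>a>0. \<exists>b>0. \<exists>c>0. \<forall>r\<ge>R. nevanlinna_T r u < a * iter_exp (n - 1) (b * r powr c))"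

end

(* Near a pole only the terms of top weight matter. If a_1, ..., a_n are nonzero, then u ^ (n+1) is
   the only term of degree n + 1, so poles are simple and residues lie in the finite set of all
   - j / a_j. For generic a no positive integer is a Fuchs index, so the residue determines the
   whole Laurent series: two poles with the same residue differ by a period. Instead of Nevanlinna
   theory, a rescaling argument controls the growth: at a point where |u| is large compared with
   the reciprocal distance to the poles, the doubling trick yields a disc on which u is nearly
   constant on its own scale, and the term u ^ (n+1) cannot be balanced there. Hence
   |u(z)| <= C max(1, 1 / dist(z, poles)). If there are finitely many poles, subtracting principal
   parts leaves a bounded entire function, and u is rational; if all periods are real multiples of
   one, the same works in the variable exp(k z); otherwise u is elliptic. The bound on |u| and the
   separation of poles with equal residue also give T(r, u) = O((1 + r)^3). *)

theory Submission
  imports Defs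
begin

section \<open>The generic set of coefficients\<close>

text \<open>The set \<open>S\<close> has to be fixed before \<open>b\<close> and \<alpha> are known.
  This is possible because both enter only below the top weight, so neither the candidate residues
  nor the Fuchs indices depend on them. Each pair of an index j, with candidate residue - j / a_j,
  and a positive integer r costs one polynomial condition on \<open>a\<close>; with r running over
  all positive integers, countably many hypersurfaces arise.

  Poles, residues and periods alone would determine u only up to an additive entire function; it is
  the growth bound that removes this freedom. Its constant does not depend on the point, because the
  equation is autonomous and the rescaled estimates look the same everywhere.

  The exponent 3 is crude: the poles up to radius r number O((1 + r)^2), and the counting integral
  costs one more power. Any power suffices: for n \<ge> 2 it stays below an exponential, and for n =
  1, where \<open>iter_exp 0\<close> is the identity, it is absorbed by r^c.\<close>

definition monomial_eval :: "(nat \<Rightarrow>\<^sub>0 nat) \<Rightarrow> (nat \<Rightarrow> complex) \<Rightarrow> complex" where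
  "monomial_eval m x = (\<Prod>i\<in>Poly_Mapping.keys m. x i ^ Poly_Mapping.lookup m i)"

lemma monomial_eval_superset:
  assumes "finite A" "Poly_Mapping.keys m \<subseteq> A"
  shows "monomial_eval m x = (\<Prod>i\<in>A. x i ^ Poly_Mapping.lookup m i)"
  unfolding monomial_eval_def
  by (rule prod.mono_neutral_left) (use assms in \<open>auto simp: in_keys_iff\<close>)

lemma monomial_eval_add: "monomial_eval (m + m') x = monomial_eval m x * monomial_eval m' x"
proof -
  let ?A = "Poly_Mapping.keys m \<union> Poly_Mapping.keys m'"
  have "monomial_eval (m + m') x = (\<Prod>i\<in>?A. x i ^ Poly_Mapping.lookup (m + m') i)"
    by (rule monomial_eval_superset) (use keys_add[of m m'] in auto)
  also have "\<dots> = monomial_eval m x * monomial_eval m' x"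
    by (simp add: lookup_add power_add prod.distrib monomial_eval_superset[of ?A])
  finally show ?thesis .
qed

lemma cmpoly_eval_conv_monomial_eval:
  "cmpoly_eval P x =
     (\<Sum>m\<in>Poly_Mapping.keys P. Poly_Mapping.lookup P m * monomial_eval m x)"
  unfolding cmpoly_eval_def monomial_eval_def ..

lemma cmpoly_eval_single: "cmpoly_eval (Poly_Mapping.single m c) x = c * monomial_eval m x"
  by (cases "c = 0") (auto simp: cmpoly_eval_conv_monomial_eval)

lemma cmpoly_eval_add: "cmpoly_eval (P + Q) x = cmpoly_eval P x + cmpoly_eval Q x"
  unfolding cmpoly_eval_conv_monomial_eval
  by (rule setsum_keys_plus_distrib) (auto simp: algebra_simps)

text \<open>Ring operations are carried out on evaluation functions; a polynomial as a syntactic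
  object is recovered only when a hypersurface has to be exhibited.\<close>

definition polynomial_functions :: "nat \<Rightarrow> ((nat \<Rightarrow> complex) \<Rightarrow> complex) set" where
  "polynomial_functions n = {f. \<exists>P. cmpoly_vars P \<subseteq> {1..n} \<and> f = cmpoly_eval P}"

lemma polynomial_functions_term:
  assumes "Poly_Mapping.keys m \<subseteq> {1..n}"
  shows "(\<lambda>x. c * monomial_eval m x) \<in> polynomial_functions n"
  unfolding polynomial_functions_def mem_Collect_eq
  by (rule exI[of _ "Poly_Mapping.single m c"])
     (use assms in \<open>auto simp: cmpoly_vars_def fun_eq_iff cmpoly_eval_single split: if_splits\<close>)

lemma polynomial_functions_add:
  assumes "f \<in> polynomial_functions n" "g \<in> polynomial_functions n"
  shows "(\<lambda>x. f x + g x) \<in> polynomial_functions n"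
proof -
  from assms obtain P Q where PQ: "cmpoly_vars P \<subseteq> {1..n}" "f = cmpoly_eval P"
    "cmpoly_vars Q \<subseteq> {1..n}" "g = cmpoly_eval Q"
    unfolding polynomial_functions_def by auto
  have "cmpoly_vars (P + Q) \<subseteq> {1..n}"
    using PQ(1,3) keys_add[of P Q] unfolding cmpoly_vars_def by blast
  then show ?thesis
    using PQ unfolding polynomial_functions_def by (auto simp: cmpoly_eval_add fun_eq_iff)
qed

lemma polynomial_functions_const: "(\<lambda>_. c) \<in> polynomial_functions n"
  using polynomial_functions_term[of 0 n c] by (simp add: monomial_eval_def)

lemma polynomial_functions_sum:
  assumes "\<And>i. i \<in> I \<Longrightarrow> f i \<in> polynomial_functions n"
  shows "(\<lambda>x. \<Sum>i\<in>I. f i x) \<in> polynomial_functions n"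
  using assms
  by (induction I rule: infinite_finite_induct)
     (auto intro: polynomial_functions_add polynomial_functions_const)

text \<open>Expanding both factors into monomials gives a double sum of terms already covered, since
  exponents add.\<close>

lemma polynomial_functions_mult:
  assumes "f \<in> polynomial_functions n" "g \<in> polynomial_functions n"
  shows "(\<lambda>x. f x * g x) \<in> polynomial_functions n"
proof -
  from assms obtain P Q where PQ: "cmpoly_vars P \<subseteq> {1..n}" "f = cmpoly_eval P"
    "cmpoly_vars Q \<subseteq> {1..n}" "g = cmpoly_eval Q"
    unfolding polynomial_functions_def by auto
  have "(\<lambda>x. f x * g x) =
    (\<lambda>x. \<Sum>m\<in>Poly_Mapping.keys P. \<Sum>m'\<in>Poly_Mapping.keys Q.
       (Poly_Mapping.lookup P m * Poly_Mapping.lookup Q m') * monomial_eval (m + m') x)"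
    by (simp add: PQ(2,4) cmpoly_eval_conv_monomial_eval sum_product monomial_eval_add mult_ac)
  also have "\<dots> \<in> polynomial_functions n"
    by (intro polynomial_functions_sum polynomial_functions_term order.trans[OF keys_add])
       (use PQ(1,3) in \<open>auto simp: cmpoly_vars_def\<close>)
  finally show ?thesis .
qed

lemma polynomial_functions_var:
  assumes "i \<in> {1..n}"
  shows "(\<lambda>x. x i) \<in> polynomial_functions n"
  using polynomial_functions_term[of "Poly_Mapping.single i 1" n 1] assms
  by (simp add: monomial_eval_def)

lemma polynomial_functions_diff:
  assumes "f \<in> polynomial_functions n" "g \<in> polynomial_functions n"
  shows "(\<lambda>x. f x - g x) \<in> polynomial_functions n"
  using polynomial_functions_add[OF assms(1) polynomial_functions_mult
      [OF polynomial_functions_const[of "-1"] assms(2)]] by simp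

lemmas polynomial_functions_intros = polynomial_functions_add polynomial_functions_diff
  polynomial_functions_mult polynomial_functions_const polynomial_functions_var

text \<open>\<open>hypersurface\<close> demands that some variable occurs. A polynomial without
  variables is constant, and being nonzero somewhere it has no zeros.\<close>

lemma zero_set_hypersurface_or_empty:
  assumes "f \<in> polynomial_functions n" "\<exists>x. f x \<noteq> 0"
  shows "hypersurface n {x \<in> cspace n. f x = 0} \<or> {x \<in> cspace n. f x = 0} = {}"
proof -
  from assms(1) obtain P where P: "cmpoly_vars P \<subseteq> {1..n}" "f = cmpoly_eval P"
    unfolding polynomial_functions_def by auto
  show ?thesis
  proof (cases "cmpoly_vars P = {}")
    case True
    then have keys: "Poly_Mapping.keys m = {}" if "m \<in> Poly_Mapping.keys P" for m
      using that unfolding cmpoly_vars_def by blast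
    have "monomial_eval m x = monomial_eval m y" if "m \<in> Poly_Mapping.keys P" for m x y
      unfolding monomial_eval_def keys[OF that] by simp
    then have const: "f x = f y" for x y
      unfolding P(2) cmpoly_eval_conv_monomial_eval by (metis (no_types, lifting) sum.cong)
    obtain x0 where "f x0 \<noteq> 0" using assms(2) by blast
    then have "f x \<noteq> 0" for x using const[of x x0] by simp
    then show ?thesis by simp
  next
    case False
    then show ?thesis using P unfolding hypersurface_def by auto
  qed
qed

lemma countable_union_of_hypersurfaces:
  assumes "countable F" "F \<subseteq> polynomial_functions n" "\<And>f. f \<in> F \<Longrightarrow> \<exists>x. f x \<noteq> 0"
  defines "S \<equiv> {x \<in> cspace n. \<exists>f\<in>F. f x = 0}"
  shows "\<exists>\<H>. countable \<H> \<and> (\<forall>H\<in>\<H>. hypersurface n H) \<and> S = \<Union>\<H>"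
proof (intro exI conjI ballI)
  \<comment> \<open>Nonzero constants among the functions produce the empty set, which is discarded
    without changing the union.\<close>
  let ?H = "(\<lambda>f. {x \<in> cspace n. f x = 0}) ` F - {{}}"
  show "countable ?H" using assms(1) by auto
  show "hypersurface n H" if "H \<in> ?H" for H
    using that zero_set_hypersurface_or_empty assms(2,3) by fastforce
  show "S = \<Union>?H" unfolding S_def by auto
qed

text \<open>Let \<open>F_k\<close> be the \<open>k\<close>-th partial product of the equation, evaluated at a solution with
  residue \<open>c = y / x\<close> at a simple pole. Then \<open>lead_coeff_seq\<close> is \<open>x ^ (k+1)\<close> times the leading
  coefficient of \<open>F_k\<close>, and \<open>fuchs_seq\<close> is \<open>x ^ k\<close> times the leading coefficient of the
  variation of \<open>F_k\<close> under a perturbation \<open>(z - z0) ^ (r - 1)\<close> of the solution. The zeros in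
  \<open>r\<close> of \<open>fuchs_seq\<close> at \<open>k = n\<close> are the Fuchs indices. The scaling by \<open>x\<close> makes both
  polynomial in \<open>a\<close> for \<open>c = - j / a j\<close>.\<close>

primrec lead_coeff_seq :: "(nat \<Rightarrow> complex) \<Rightarrow> complex \<Rightarrow> complex \<Rightarrow> nat \<Rightarrow> complex" where
  "lead_coeff_seq a x y 0 = y"
| "lead_coeff_seq a x y (Suc k) = (- of_nat (Suc k) * x - a (Suc k) * y) * lead_coeff_seq a x y k"

primrec fuchs_seq :: "(nat \<Rightarrow> complex) \<Rightarrow> nat \<Rightarrow> complex \<Rightarrow> complex \<Rightarrow> nat \<Rightarrow> complex" where
  "fuchs_seq a r x y 0 = 1"
| "fuchs_seq a r x y (Suc k) =
     ((of_nat r - of_nat (Suc k)) * x - a (Suc k) * y) * fuchs_seq a r x y k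
       - a (Suc k) * lead_coeff_seq a x y k"

text \<open>Homogeneity in (x, y), of degree k + 1 here and k for \<open>fuchs_seq\<close>. It
  converts between (a_j, - j) and (1, - j / a_j), and at the test point between (j, - j) and (1, -
  1).\<close>

lemma lead_coeff_seq_scale:
  "lead_coeff_seq a (s * x) (s * y) k = s ^ Suc k * lead_coeff_seq a x y k"
  by (induction k) (auto simp: algebra_simps)

lemma fuchs_seq_scale: "fuchs_seq a r (s * x) (s * y) k = s ^ k * fuchs_seq a r x y k"
  by (induction k) (auto simp: lead_coeff_seq_scale algebra_simps)

lemma fuchs_seq_polynomial:
  assumes "j \<in> {1..n}" "k \<le> n"
  shows "(\<lambda>a. fuchs_seq a r (a j) (- of_nat j) k) \<in> polynomial_functions n"
proof -
  have lead: "(\<lambda>a. lead_coeff_seq a (a j) (- of_nat j) k) \<in> polynomial_functions n" if "k \<le> n" for k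
    using that
  proof (induction k)
    case (Suc k)
    then show ?case
      unfolding lead_coeff_seq.simps by (intro polynomial_functions_intros) (use assms(1) in auto)
  qed (simp add: polynomial_functions_const)
  show ?thesis using assms(2)
  proof (induction k)
    case (Suc k)
    then show ?case
      unfolding fuchs_seq.simps by (intro polynomial_functions_intros lead) (use assms(1) in auto)
  qed (simp add: polynomial_functions_const)
qed

text \<open>The test point \<open>a k = k\<close>, where every residue \<open>- j / a j\<close> is \<open>-1\<close>, shows that no positive
  integer is generically a Fuchs index: there the Fuchs indices are \<open>-1\<close> and \<open>0\<close>.\<close>

lemma fuchs_seq_test_point:
  assumes "k \<ge> 1"
  shows "fuchs_seq of_nat r 1 (-1) k = (of_nat r + 1) * of_nat r ^ (k - 1)"
proof -
  \<comment> \<open>Each factor of the recursion is - (k + 1) + (k + 1). Hence only the step from 0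
    to 1, where the leading coefficient is - 1, feels the last term of \<open>fuchs_seq\<close> and
    yields r + 1; every later step multiplies by r.\<close>
  have lead: "lead_coeff_seq of_nat 1 (-1) k = 0" if "k \<ge> 1" for k
    using that by (induction k) auto
  show ?thesis using assms
  proof (induction k rule: dec_induct)
    case (step k)
    then show ?case by (cases k) (simp_all add: lead algebra_simps)
  qed (simp add: algebra_simps)
qed

text \<open>All j are tested because any - j / a_j may occur as a residue; r = 0 is left out because
  the residue itself is prescribed when two solutions are compared.\<close>

definition generic_coeffs :: "nat \<Rightarrow> (nat \<Rightarrow> complex) \<Rightarrow> bool" where
  "generic_coeffs n a \<longleftrightarrow> (\<forall>j\<in>{1..n}. a j \<noteq> 0) \<and>
     (\<forall>j\<in>{1..n}. \<forall>r\<ge>1. fuchs_seq a r 1 (- of_nat j / a j) n \<noteq> 0)"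

lemma nongeneric_coeffs_hypersurfaces:
  fixes n :: nat
  assumes "n \<ge> 1"
  shows "\<exists>\<H>. countable \<H> \<and> (\<forall>H\<in>\<H>. hypersurface n H) \<and>
    {a \<in> cspace n. \<not> generic_coeffs n a} = \<Union>\<H>"
proof -
  \<comment> \<open>The factor \<open>a j\<close> merges the two kinds of conditions: it detects a_j
    = 0, and away from there the other factor is the Fuchs polynomial times a_j^n.\<close>
  define P where "P j r = (\<lambda>a :: nat \<Rightarrow> complex. a j * fuchs_seq a r (a j) (- of_nat j) n)" for j r
  let ?F = "(\<lambda>(j, r). P j r) ` ({1..n} \<times> {1..})"
  have "P j r \<in> polynomial_functions n" if "j \<in> {1..n}" for j r
    unfolding P_def using that
    by (intro polynomial_functions_mult fuchs_seq_polynomial polynomial_functions_var) auto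
  moreover have "P j r of_nat \<noteq> 0" if "j \<in> {1..n}" "r \<ge> 1" for j r
  proof -
    have "P j r of_nat = of_nat j ^ Suc n * (of_nat (Suc r) * of_nat r ^ (n - 1))"
      using fuchs_seq_scale[of of_nat r "of_nat j" 1 "-1" n] fuchs_seq_test_point[OF assms, of r]
      by (simp add: P_def algebra_simps)
    then show ?thesis using that by (simp del: of_nat_Suc)
  qed
  ultimately have "\<exists>\<H>. countable \<H> \<and> (\<forall>H\<in>\<H>. hypersurface n H) \<and>
    {a \<in> cspace n. \<exists>f\<in>?F. f a = 0} = \<Union>\<H>"
    by (intro countable_union_of_hypersurfaces) fast+
  moreover have "generic_coeffs n a \<longleftrightarrow> \<not> (\<exists>f\<in>?F. f a = 0)" for a
  proof -
    have zero: "P j r a = 0 \<longleftrightarrow> a j = 0 \<or> fuchs_seq a r 1 (- of_nat j / a j) n = 0" for j r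
    proof (cases "a j = 0")
      case False
      then have "fuchs_seq a r (a j) (- of_nat j) n = a j ^ n * fuchs_seq a r 1 (- of_nat j / a j) n"
        using fuchs_seq_scale[of a r "a j" 1 "- of_nat j / a j" n] by simp
      then have "P j r a = a j ^ Suc n * fuchs_seq a r 1 (- of_nat j / a j) n"
        by (simp add: P_def)
      then show ?thesis using False by (metis mult_eq_0_iff power_eq_0_iff)
    qed (simp add: P_def)
    have "(\<exists>f\<in>?F. f a = 0) \<longleftrightarrow> (\<exists>j\<in>{1..n}. \<exists>r\<ge>1. P j r a = 0)"
      by auto
    then show ?thesis unfolding generic_coeffs_def zero by blast
  qed
  ultimately show ?thesis by (simp only: not_not)
qed

section \<open>Expansions at a simple pole\<close>

text \<open>The form is chosen for leading coefficients: the exponent drops by one, and at z0 the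
  new holomorphic factor takes the value m * G z0.\<close>

lemma deriv_mult_power_int:
  assumes "G holomorphic_on ball z0 \<rho>" "z \<in> ball z0 \<rho> - {z0}"
    and "\<And>w. w \<in> ball z0 \<rho> - {z0} \<Longrightarrow> F w = G w * (w - z0) powi m"
  shows "(F has_field_derivative ((z - z0) * deriv G z + of_int m * G z) * (z - z0) powi (m - 1)) (at z)"
proof (rule has_field_derivative_transform_within_open[where S = "ball z0 \<rho> - {z0}"])
  have nz: "z - z0 \<noteq> 0" using assms(2) by auto
  have "(G has_field_derivative deriv G z) (at z)"
    using assms(1,2) by (intro holomorphic_derivI[of _ "ball z0 \<rho>"]) auto
  then show "((\<lambda>w. G w * (w - z0) powi m) has_field_derivative
      ((z - z0) * deriv G z + of_int m * G z) * (z - z0) powi (m - 1)) (at z)"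
    using nz by (auto intro!: derivative_eq_intros simp: power_int_diff field_simps)
qed (use assms in auto)

text \<open>Multiplication by u raises the pole order by p, differentiation only by 1. For p = 1
  both contribute to the leading coefficient; for p \<ge> 2 only the products do.\<close>

lemma factor_product_expansion:
  assumes "p \<ge> 1" "\<rho> > 0" "U holomorphic_on ball z0 \<rho>"
    and u: "\<And>z. z \<in> ball z0 \<rho> - {z0} \<Longrightarrow> u z = U z * (z - z0) powi (- int p)"
  defines "c \<equiv> U z0"
  shows "\<exists>G. G holomorphic_on ball z0 \<rho> \<and>
    G z0 = (if p = 1 then lead_coeff_seq a 1 c k else c * (\<Prod>j=1..k. - a j * c)) \<and>
    (\<forall>z\<in>ball z0 \<rho> - {z0}.
       factor_product a b u k (\<lambda>w. u w - \<alpha>) z = G z * (z - z0) powi (- int (p * Suc k)))"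
proof (induction k)
  case 0
  show ?case
  proof (intro exI conjI ballI)
    show "(\<lambda>z. U z - \<alpha> * (z - z0) ^ p) holomorphic_on ball z0 \<rho>"
      by (intro holomorphic_intros assms)
    fix z assume "z \<in> ball z0 \<rho> - {z0}"
    then show "factor_product a b u 0 (\<lambda>w. u w - \<alpha>) z =
        (U z - \<alpha> * (z - z0) ^ p) * (z - z0) powi (- int (p * Suc 0))"
      using u by (simp add: power_int_minus field_simps)
  qed (use assms(1) in \<open>auto simp: c_def\<close>)
next
  case (Suc k)
  then obtain G where G: "G holomorphic_on ball z0 \<rho>"
    "G z0 = (if p = 1 then lead_coeff_seq a 1 c k else c * (\<Prod>j=1..k. - a j * c))"
    "\<And>z. z \<in> ball z0 \<rho> - {z0} \<Longrightarrow>
       factor_product a b u k (\<lambda>w. u w - \<alpha>) z = G z * (z - z0) powi (- int (p * Suc k))"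
    by blast
  let ?a = "a (Suc k)" and ?b = "b (Suc k)" and ?m = "- int (p * Suc k)"
  \<comment> \<open>The power p - 1 is the lag of the derivative behind the product; at z0 it is 1
    for p = 1 and 0 otherwise.\<close>
  define H where "H = (\<lambda>z. (z - z0) ^ (p - 1) * ((z - z0) * deriv G z + of_int ?m * G z)
    - (?a * U z + ?b * (z - z0) ^ p) * G z)"
  show ?case
  proof (intro exI conjI ballI)
    show "H holomorphic_on ball z0 \<rho>"
      unfolding H_def by (intro holomorphic_intros assms G(1)) auto
    show "H z0 = (if p = 1 then lead_coeff_seq a 1 c (Suc k) else c * (\<Prod>j=1..Suc k. - a j * c))"
      using assms(1) by (auto simp: H_def G(2) c_def algebra_simps power_0_left)
    fix z assume z: "z \<in> ball z0 \<rho> - {z0}"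
    then have nz: "z - z0 \<noteq> 0" by auto
    have "deriv (factor_product a b u k (\<lambda>w. u w - \<alpha>)) z =
        ((z - z0) * deriv G z + of_int ?m * G z) * (z - z0) powi (?m - 1)"
      by (rule DERIV_imp_deriv, rule deriv_mult_power_int[OF G(1) z G(3)]) auto
    moreover have "(z - z0) powi (?m - 1) = (z - z0) ^ (p - 1) * (z - z0) powi (- int (p * Suc (Suc k)))"
    proof -
      have "?m - 1 = int (p - 1) + (- int (p * Suc (Suc k)))"
        using assms(1) by (simp add: of_nat_diff)
      then show ?thesis using nz by (metis power_int_add power_int_of_nat)
    qed
    moreover have pw: "(z - z0) powi ?m = (z - z0) ^ p * (z - z0) powi (- int (p * Suc (Suc k)))"
    proof -
      have "?m = int p + (- int (p * Suc (Suc k)))" by simp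
      then show ?thesis using nz by (metis power_int_add power_int_of_nat)
    qed
    moreover have "U z = u z * (z - z0) ^ p"
      using u[OF z] nz by (simp add: power_int_minus field_simps)
    ultimately show "factor_product a b u (Suc k) (\<lambda>w. u w - \<alpha>) z =
        H z * (z - z0) powi (- int (p * Suc (Suc k)))"
      unfolding factor_product.simps D_minus_def G(3)[OF z] H_def
      by (simp only:) (simp only: algebra_simps)
  qed
qed

text \<open>With F and G the partial products for u and v, the next difference is D(F - G) - (a u +
  b) (F - G) - a (u - v) G. All three terms have order at least r - 2 - k; the first two give the
  factor r - (k + 1) - a c, and the last brings in the leading coefficient of G.\<close>

lemma factor_product_variation:
  fixes r :: nat
  assumes "\<rho> > 0" "U holomorphic_on ball z0 \<rho>" "V holomorphic_on ball z0 \<rho>"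
    "W holomorphic_on ball z0 \<rho>" "U z0 = c" "V z0 = c"
    and u: "\<And>z. z \<in> ball z0 \<rho> - {z0} \<Longrightarrow> u z = U z * (z - z0) powi (- 1)"
    and v: "\<And>z. z \<in> ball z0 \<rho> - {z0} \<Longrightarrow> v z = V z * (z - z0) powi (- 1)"
    and uv: "\<And>z. z \<in> ball z0 \<rho> - {z0} \<Longrightarrow> u z - v z = W z * (z - z0) powi (int r - 1)"
  shows "\<exists>h. h holomorphic_on ball z0 \<rho> \<and> h z0 = W z0 * fuchs_seq a r 1 c k \<and>
    (\<forall>z\<in>ball z0 \<rho> - {z0}.
       factor_product a b u k (\<lambda>w. u w - \<alpha>) z - factor_product a b v k (\<lambda>w. v w - \<alpha>) z =
       h z * (z - z0) powi (int r - 1 - int k))"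
proof (induction k)
  case 0
  then show ?case by (intro exI[of _ W]) (use assms(4) uv in auto)
next
  case (Suc k)
  let ?u = "factor_product a b u k (\<lambda>w. u w - \<alpha>)" and ?v = "factor_product a b v k (\<lambda>w. v w - \<alpha>)"
  from Suc obtain h where h: "h holomorphic_on ball z0 \<rho>" "h z0 = W z0 * fuchs_seq a r 1 c k"
    "\<And>z. z \<in> ball z0 \<rho> - {z0} \<Longrightarrow> ?u z - ?v z = h z * (z - z0) powi (int r - 1 - int k)"
    by blast
  from factor_product_expansion[of 1 \<rho> U z0 u a k b \<alpha>] assms obtain F where
    F: "F holomorphic_on ball z0 \<rho>"
       "\<And>z. z \<in> ball z0 \<rho> - {z0} \<Longrightarrow> ?u z = F z * (z - z0) powi (- int (1 * Suc k))"
    by auto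
  from factor_product_expansion[of 1 \<rho> V z0 v a k b \<alpha>] assms obtain G where
    G: "G holomorphic_on ball z0 \<rho>" "G z0 = lead_coeff_seq a 1 c k"
       "\<And>z. z \<in> ball z0 \<rho> - {z0} \<Longrightarrow> ?v z = G z * (z - z0) powi (- int (1 * Suc k))"
    by auto
  let ?a = "a (Suc k)" and ?b = "b (Suc k)" and ?m = "int r - 1 - int k"
  define H where "H = (\<lambda>z. (z - z0) * deriv h z + of_int ?m * h z
    - (?a * U z + ?b * (z - z0)) * h z - ?a * W z * G z)"
  show ?case
  proof (intro exI conjI ballI)
    show "H holomorphic_on ball z0 \<rho>"
      unfolding H_def by (intro holomorphic_intros assms G(1) h(1)) auto
    show "H z0 = W z0 * fuchs_seq a r 1 c (Suc k)"
      by (simp add: H_def G(2) h(2) assms algebra_simps)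
    fix z assume z: "z \<in> ball z0 \<rho> - {z0}"
    then have nz: "z - z0 \<noteq> 0" by auto
    define d where "d = z - z0"
    have d: "d \<noteq> 0" using nz by (simp add: d_def)
    have "?u field_differentiable at z" "?v field_differentiable at z"
      using deriv_mult_power_int[OF F(1) z F(2)] deriv_mult_power_int[OF G(1) z G(3)]
      unfolding field_differentiable_def by blast+
    then have "deriv ?u z - deriv ?v z = deriv (\<lambda>w. ?u w - ?v w) z"
      by (simp add: deriv_diff)
    also have "\<dots> = (d * deriv h z + of_int ?m * h z) * d powi (?m - 1)"
      unfolding d_def by (rule DERIV_imp_deriv, rule deriv_mult_power_int[OF h(1) z h(3)]) auto
    finally have eq: "deriv ?u z - deriv ?v z = \<dots>" .
    define q where "q = d powi (?m - 1)"
    have "d powi (1 + (?m - 1)) = d * q"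
      using d by (subst power_int_add) (simp_all add: q_def)
    moreover have "1 + (?m - 1) = ?m" by presburger
    ultimately have dq: "d powi ?m = d * q" by (simp only:)
    have uv': "?u z = ?v z + h z * (d * q)"
      using h(3)[OF z] unfolding d_def[symmetric] dq by (simp only: diff_eq_eq add.commute)
    have uz: "u z * d = U z"
      using u[OF z] d by (simp add: d_def power_int_minus)
    have "(u z - v z) * ?v z = W z * G z * (d powi (int r - 1) * d powi (- int (Suc k)))"
      by (simp only: uv[OF z] G(3)[OF z] d_def) (simp add: algebra_simps)
    also have "d powi (int r - 1) * d powi (- int (Suc k)) = d powi ((int r - 1) + (- int (Suc k)))"
      using d by (subst power_int_add) auto
    also have "(int r - 1) + (- int (Suc k)) = ?m - 1" by simp
    finally have vz: "(u z - v z) * ?v z = W z * G z * q" unfolding q_def .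
    have "factor_product a b u (Suc k) (\<lambda>w. u w - \<alpha>) z - factor_product a b v (Suc k) (\<lambda>w. v w - \<alpha>) z
       = (deriv ?u z - deriv ?v z) - (?a * u z + ?b) * (?u z - ?v z) - ?a * ((u z - v z) * ?v z)"
      by (simp add: D_minus_def algebra_simps)
    also have "\<dots> = H z * q"
      unfolding eq vz q_def[symmetric] H_def d_def[symmetric] uz[symmetric] using uv'
      by (simp add: algebra_simps)
    finally show "factor_product a b u (Suc k) (\<lambda>w. u w - \<alpha>) z
        - factor_product a b v (Suc k) (\<lambda>w. v w - \<alpha>) z = H z * (z - z0) powi (int r - 1 - int (Suc k))"
      unfolding q_def d_def by simp
  qed
qed

text \<open>The power has no zeros off z0, so G vanishes there, and at z0 by continuity.\<close>

lemma vanishing_expansion_coeff: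
  assumes "\<rho> > 0" "G holomorphic_on ball z0 \<rho>"
    and "\<And>z. z \<in> ball z0 \<rho> - {z0} \<Longrightarrow> G z * (z - z0) powi m = 0"
  shows "G z0 = 0"
proof -
  have "isCont G z0"
    using assms(1) holomorphic_on_imp_continuous_on[OF assms(2)]
    by (simp add: continuous_on_eq_continuous_at)
  then have "(G \<longlongrightarrow> G z0) (at z0)" by (simp add: isCont_def)
  moreover have "eventually (\<lambda>z. G z = 0) (at z0)"
    using eventually_at_ball'[OF assms(1), of z0 UNIV]
    by eventually_elim (use assms(3) in \<open>auto simp: dist_commute\<close>)
  then have "(G \<longlongrightarrow> 0) (at z0)" by (simp add: tendsto_eventually)
  ultimately show ?thesis by (rule tendsto_unique[rotated]) auto
qed

section \<open>Meromorphic functions with the value 0 at their poles\<close>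

lemma nicely_meromorphic_isolated_poles:
  assumes "u nicely_meromorphic_on UNIV"
  shows "\<not> z islimpt {w. is_pole u w}"
  using assms meromorphic_on_isolated_singularity[of u]
  unfolding nicely_meromorphic_on_def by (meson not_islimpt_poles meromorphic_on_subset subset_UNIV)

lemma nicely_meromorphic_holomorphic_off_poles:
  assumes "u nicely_meromorphic_on UNIV" "\<And>z. z \<in> A \<Longrightarrow> \<not> is_pole u z"
  shows "u holomorphic_on A"
  using assms nicely_meromorphic_on_imp_analytic_at
  by (meson UNIV_I analytic_imp_holomorphic analytic_on_analytic_at)

lemma nicely_meromorphic_at_pole:
  assumes "u nicely_meromorphic_on UNIV" "is_pole u z"
  shows "u z = 0"
  using assms is_pole_imp_not_essential
  unfolding nicely_meromorphic_on_def is_pole_def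
  by (metis UNIV_I at_neq_bot not_tendsto_and_filterlim_at_infinity)

lemma nicely_meromorphic_eqI:
  assumes "u nicely_meromorphic_on UNIV" "v nicely_meromorphic_on UNIV"
    and "eventually (\<lambda>w. u w = v w) (at z)"
  shows "u z = v z"
proof (cases "is_pole u z")
  case True
  then have "is_pole v z" using is_pole_cong[OF assms(3) refl] by simp
  then show ?thesis using True nicely_meromorphic_at_pole assms(1,2) by metis
next
  case False
  then have "\<not> is_pole v z" using is_pole_cong[OF assms(3) refl] by simp
  then have "u \<midarrow>z\<rightarrow> u z" "v \<midarrow>z\<rightarrow> v z"
    using False assms(1,2) unfolding nicely_meromorphic_on_def by auto
  then show ?thesis using tendsto_cong[OF assms(3)] LIM_unique by metis
qed

text \<open>At a common pole the difference may have a removable singularity with the wrong value.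
  The identity theorem is therefore applied to \<open>remove_sings\<close> of the difference, and
  the conclusion is carried back on punctured neighbourhoods.\<close>

lemma nicely_meromorphic_identity:
  assumes "u nicely_meromorphic_on UNIV" "v nicely_meromorphic_on UNIV"
    and "eventually (\<lambda>w. u w = v w) (at z0)"
  shows "u = v"
proof
  fix z
  have mero: "(\<lambda>w. u w - v w) meromorphic_on UNIV"
    using assms(1,2) unfolding nicely_meromorphic_on_def by (auto intro: meromorphic_intros)
  then have iso: "isolated_singularity_at (\<lambda>w. u w - v w) z" for z
    by (meson UNIV_I meromorphic_on_isolated_singularity meromorphic_on_subset subset_UNIV)
  have "eventually (\<lambda>w. remove_sings (\<lambda>w. u w - v w) w = 0) (at z0)"
    using eventually_remove_sings_eq_at[OF iso] assms(3) by eventually_elim simp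
  then have freq: "frequently (\<lambda>w. remove_sings (\<lambda>w. u w - v w) w = 0) (at z0)"
    by (simp add: eventually_frequently)
  have zero: "remove_sings (\<lambda>w. u w - v w) w = 0" for w
    by (rule frequently_eq_meromorphic_imp_constant[OF freq remove_sings_nicely_meromorphic[OF mero]])
       auto
  have "eventually (\<lambda>w. u w = v w) (at z)"
    using eventually_remove_sings_eq_at[OF iso, of z]
    by eventually_elim (metis zero eq_iff_diff_eq_0)
  then show "u z = v z" by (rule nicely_meromorphic_eqI[OF assms(1,2)])
qed

lemma nicely_meromorphic_pole_expansion:
  assumes "u nicely_meromorphic_on UNIV" "is_pole u z0"
  obtains \<rho> U where "\<rho> > 0" "U holomorphic_on ball z0 \<rho>" "U z0 \<noteq> 0" "zorder u z0 < 0"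
    "\<And>z. z \<in> ball z0 \<rho> - {z0} \<Longrightarrow> \<not> is_pole u z \<and> u z = U z * (z - z0) powi zorder u z0"
proof -
  have "\<exists>r>0. \<forall>z. is_pole u z \<longrightarrow> z = z0 \<or> \<not> dist z z0 < r"
    using nicely_meromorphic_isolated_poles[OF assms(1), of z0] unfolding islimpt_approachable by blast
  then obtain r where r: "r > 0" "\<And>z. z \<in> ball z0 r - {z0} \<Longrightarrow> \<not> is_pole u z"
    by (auto simp: dist_commute)
  then have "u holomorphic_on ball z0 r - {z0}"
    using nicely_meromorphic_holomorphic_off_poles[OF assms(1)] by blast
  from zorder_exist_pole[OF this _ _ assms(2)] r(1) obtain s where
    "zorder u z0 < 0" "zor_poly u z0 z0 \<noteq> 0" "s > 0" "cball z0 s \<subseteq> ball z0 r"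
    "zor_poly u z0 holomorphic_on cball z0 s"
    "\<forall>w\<in>cball z0 s - {z0}. u w = zor_poly u z0 w / (w - z0) ^ nat (- zorder u z0)"
    by auto
  moreover from this have "u w = zor_poly u z0 w * (w - z0) powi zorder u z0"
    if "w \<in> ball z0 s - {z0}" for w
    using that by (auto simp: power_int_def field_simps)
  moreover have "zor_poly u z0 holomorphic_on ball z0 s"
    using calculation(5) ball_subset_cball holomorphic_on_subset by blast
  moreover have "\<not> is_pole u w" if "w \<in> ball z0 s - {z0}" for w
    using that calculation(4) ball_subset_cball r(2) by blast
  ultimately show ?thesis by (intro that[of s "zor_poly u z0"]) blast+
qed

section \<open>Poles and periods of solutions\<close>

lemma meromorphic_solution_nicely:
  "meromorphic_solution n a b \<alpha> u \<Longrightarrow> u nicely_meromorphic_on UNIV"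
  by (simp add: meromorphic_solution_def)

text \<open>Since \<open>u ^ (n+1)\<close> is the only term of degree \<open>n + 1\<close>, a pole of order \<open>p \<ge> 2\<close> would leave the
  leading coefficient \<open>(- 1) ^ n * a 1 * \<dots> * a n * c ^ (n+1) \<noteq> 0\<close>.\<close>

lemma solution_pole:
  assumes sol: "meromorphic_solution n a b \<alpha> u" and a: "\<And>j. j \<in> {1..n} \<Longrightarrow> a j \<noteq> 0"
    and pole: "is_pole u z0"
  obtains \<rho> U where "\<rho> > 0" "U holomorphic_on ball z0 \<rho>" "zorder u z0 = -1"
    "U z0 = residue u z0" "residue u z0 \<in> (\<lambda>j. - of_nat j / a j) ` {1..n}"
    "\<And>z. z \<in> ball z0 \<rho> - {z0} \<Longrightarrow> \<not> is_pole u z \<and> u z = U z * (z - z0) powi (-1)"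
proof -
  note nice = meromorphic_solution_nicely[OF sol]
  from nicely_meromorphic_pole_expansion[OF nice pole] obtain \<rho> U where
    U: "\<rho> > 0" "U holomorphic_on ball z0 \<rho>" "U z0 \<noteq> 0" "zorder u z0 < 0"
    and u: "\<And>z. z \<in> ball z0 \<rho> - {z0} \<Longrightarrow> \<not> is_pole u z \<and> u z = U z * (z - z0) powi zorder u z0"
    by blast
  define p where "p = nat (- zorder u z0)"
  have p: "p \<ge> 1" "zorder u z0 = - int p" using U(4) by (auto simp: p_def)
  from factor_product_expansion[OF p(1) U(1,2), of u a n b \<alpha>] u p(2) obtain G where
    G: "G holomorphic_on ball z0 \<rho>"
    "G z0 = (if p = 1 then lead_coeff_seq a 1 (U z0) n else U z0 * (\<Prod>j=1..n. - a j * U z0))"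
    "\<And>z. z \<in> ball z0 \<rho> - {z0} \<Longrightarrow>
       factor_product a b u n (\<lambda>w. u w - \<alpha>) z = G z * (z - z0) powi (- int (p * Suc n))"
    by auto
  have "G z0 = 0"
    by (rule vanishing_expansion_coeff[OF U(1) G(1)])
       (use u G(3) sol in \<open>auto simp: meromorphic_solution_def\<close>)
  moreover have "U z0 * (\<Prod>j=1..n. - a j * U z0) \<noteq> 0"
    using U(3) a by auto
  ultimately have p1: "p = 1" and lead: "lead_coeff_seq a 1 (U z0) n = 0"
    using G(2) by (auto split: if_splits)
  \<comment> \<open>At a simple pole the leading coefficient is \<open>U z0\<close> times the
    product of all - j - a_j * U z0. Since \<open>U z0\<close> is not 0, one of these factors must
    vanish, which determines the residue.\<close>
  have "\<exists>j\<in>{1..k}. of_nat j + a j * U z0 = 0" if "lead_coeff_seq a 1 (U z0) k = 0" for k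
    using that
  proof (induction k)
    case (Suc k)
    then consider "- of_nat (Suc k) * 1 - a (Suc k) * U z0 = 0" | "lead_coeff_seq a 1 (U z0) k = 0"
      by auto
    then show ?case
    proof cases
      case 1
      have "of_nat (Suc k) + a (Suc k) * U z0 = - (- of_nat (Suc k) * 1 - a (Suc k) * U z0)" by simp
      also have "\<dots> = 0" by (simp only: 1 minus_zero)
      finally have "of_nat (Suc k) + a (Suc k) * U z0 = 0" .
      then show ?thesis by force
    next
      case 2
      then show ?thesis using Suc.IH by force
    qed
  qed (use U(3) in auto)
  from this[OF lead] obtain j where j: "j \<in> {1..n}" "of_nat j + a j * U z0 = 0" by blast
  then have "U z0 = - of_nat j / a j"
    using a[OF j(1)] by (simp add: field_simps eq_neg_iff_add_eq_0 add.commute)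
  moreover have "residue u z0 = U z0"
  proof -
    have "residue u z0 = residue (\<lambda>w. U w / (w - z0)) z0"
    proof (rule residue_cong)
      show "eventually (\<lambda>z. u z = U z / (z - z0)) (at z0)"
        using eventually_at_ball'[OF U(1), of z0 UNIV]
        by eventually_elim (use u p(2) p1 in \<open>auto simp: power_int_minus divide_inverse dist_commute\<close>)
    qed simp
    then show ?thesis using residue_simple[OF open_ball _ U(2)] U(1) by simp
  qed
  ultimately show ?thesis
    by (intro that[of \<rho> U]) (use U u p(2) p1 j in auto)
qed

lemma factor_product_shift:
  "factor_product a b (\<lambda>z. u (z + s)) k (\<lambda>z. F (z + s)) = (\<lambda>z. factor_product a b u k F (z + s))"
proof (induction k)
  case (Suc k)
  have "deriv (\<lambda>z. f (z + s)) z = deriv f (z + s)" for f :: "complex \<Rightarrow> complex" and z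
    by (simp add: deriv_def DERIV_shift)
  then show ?case by (simp add: Suc D_minus_def)
qed simp

lemma nicely_meromorphic_shift:
  assumes "u nicely_meromorphic_on UNIV"
  shows "(\<lambda>z. u (z + s)) nicely_meromorphic_on UNIV"
  unfolding nicely_meromorphic_on_def
proof (intro conjI ballI)
  show "(\<lambda>z. u (z + s)) meromorphic_on UNIV"
    using assms unfolding nicely_meromorphic_on_def
    by (intro meromorphic_on_compose[of u UNIV "\<lambda>z. z + s" UNIV] analytic_intros) auto
  fix z
  have "is_pole u (z + s) \<and> u (z + s) = 0 \<or> u \<midarrow>z + s\<rightarrow> u (z + s)"
    using assms unfolding nicely_meromorphic_on_def by auto
  then show "is_pole (\<lambda>z. u (z + s)) z \<and> u (z + s) = 0 \<or> (\<lambda>z. u (z + s)) \<midarrow>z\<rightarrow> u (z + s)"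
    using is_pole_shift_iff[of u s z] LIM_offset[of u "u (z + s)" "z + s" s]
    by (auto simp: o_def add_ac)
qed

lemma meromorphic_solution_shift:
  assumes "meromorphic_solution n a b \<alpha> u"
  shows "meromorphic_solution n a b \<alpha> (\<lambda>z. u (z + s))"
  unfolding meromorphic_solution_def
proof (intro conjI allI impI)
  show "(\<lambda>z. u (z + s)) nicely_meromorphic_on UNIV"
    by (rule nicely_meromorphic_shift[OF meromorphic_solution_nicely[OF assms]])
  show "factor_product a b (\<lambda>z. u (z + s)) n (\<lambda>w. u (w + s) - \<alpha>) z = 0"
    if "\<not> is_pole (\<lambda>z. u (z + s)) z" for z
    using that assms factor_product_shift[of a b u s n "\<lambda>w. u w - \<alpha>"] is_pole_shift_iff[of u s z]
    by (auto simp: o_def add_ac meromorphic_solution_def)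
qed

text \<open>If two solutions with a common pole and residue differ, their difference has leading term
  \<open>(z - z0) ^ (r - 1)\<close> for some \<open>r \<ge> 1\<close>, and \<open>r\<close> is then a Fuchs index.\<close>

lemma solution_unique_by_residue:
  assumes gen: "generic_coeffs n a"
    and u: "meromorphic_solution n a b \<alpha> u" "is_pole u z0"
    and v: "meromorphic_solution n a b \<alpha> v" "is_pole v z0"
    and res: "residue u z0 = residue v z0"
  shows "u = v"
proof -
  have a: "a j \<noteq> 0" if "j \<in> {1..n}" for j using gen that by (simp add: generic_coeffs_def)
  from solution_pole[OF u(1) a u(2)] obtain \<rho>1 U where
    U: "\<rho>1 > 0" "U holomorphic_on ball z0 \<rho>1" "U z0 = residue u z0"
      "residue u z0 \<in> (\<lambda>j. - of_nat j / a j) ` {1..n}"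
      "\<And>z. z \<in> ball z0 \<rho>1 - {z0} \<Longrightarrow> \<not> is_pole u z \<and> u z = U z * (z - z0) powi (-1)" by metis
  from solution_pole[OF v(1) a v(2)] obtain \<rho>2 V where
    V: "\<rho>2 > 0" "V holomorphic_on ball z0 \<rho>2" "V z0 = residue v z0"
      "\<And>z. z \<in> ball z0 \<rho>2 - {z0} \<Longrightarrow> \<not> is_pole v z \<and> v z = V z * (z - z0) powi (-1)" by metis
  define \<rho> where "\<rho> = min \<rho>1 \<rho>2"
  have \<rho>: "\<rho> > 0" "ball z0 \<rho> \<subseteq> ball z0 \<rho>1" "ball z0 \<rho> \<subseteq> ball z0 \<rho>2"
    using U(1) V(1) by (auto simp: \<rho>_def)
  have hol: "U holomorphic_on ball z0 \<rho>" "V holomorphic_on ball z0 \<rho>"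
    using U(2) V(2) \<rho> holomorphic_on_subset by blast+
  have "(\<lambda>z. U z - V z) constant_on ball z0 \<rho>"
  proof (rule ccontr)
    assume "\<not> (\<lambda>z. U z - V z) constant_on ball z0 \<rho>"
    with holomorphic_factor_zero_nonconstant[of "\<lambda>z. U z - V z" "ball z0 \<rho>" z0] hol \<rho>(1) U(3) V(3) res
    obtain g s m where g: "0 < m" "0 < s" "ball z0 s \<subseteq> ball z0 \<rho>" "g holomorphic_on ball z0 s"
      "\<And>w. w \<in> ball z0 s \<Longrightarrow> U w - V w = (w - z0) ^ m * g w" "\<And>w. w \<in> ball z0 s \<Longrightarrow> g w \<noteq> 0"
      by (metis (no_types, lifting) centre_in_ball connected_ball diff_self holomorphic_on_diff open_ball)
    have sub: "ball z0 s \<subseteq> ball z0 \<rho>1" "ball z0 s \<subseteq> ball z0 \<rho>2" using g(3) \<rho> by blast+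
    have diff: "u z - v z = g z * (z - z0) powi (int m - 1)" if z: "z \<in> ball z0 s - {z0}" for z
    proof -
      have "z \<in> ball z0 \<rho>1 - {z0}" "z \<in> ball z0 \<rho>2 - {z0}" using z sub by blast+
      then have "u z - v z = (U z - V z) * (z - z0) powi (-1)"
        using U(5) V(4) by (simp add: algebra_simps)
      also have "\<dots> = g z * ((z - z0) powi int m * (z - z0) powi (-1))"
        using g(5) z by simp
      also have "(z - z0) powi int m * (z - z0) powi (-1) = (z - z0) powi (int m - 1)"
        using z by (subst power_int_add [symmetric]) auto
      finally show ?thesis .
    qed
    obtain h where h: "h holomorphic_on ball z0 s" "h z0 = g z0 * fuchs_seq a m 1 (residue u z0) n"
      "\<And>z. z \<in> ball z0 s - {z0} \<Longrightarrow>
         factor_product a b u n (\<lambda>w. u w - \<alpha>) z - factor_product a b v n (\<lambda>w. v w - \<alpha>) z =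
         h z * (z - z0) powi (int m - 1 - int n)"
      using factor_product_variation[OF g(2) holomorphic_on_subset[OF U(2) sub(1)]
          holomorphic_on_subset[OF V(2) sub(2)] g(4) U(3) V(3)[folded res], of u v m a n b \<alpha>]
        U(5) V(4) sub diff by blast
    have "h z0 = 0"
    proof (rule vanishing_expansion_coeff[OF g(2) h(1)])
      fix z assume z: "z \<in> ball z0 s - {z0}"
      then have "\<not> is_pole u z" "\<not> is_pole v z" using z U(5) V(4) sub by blast+
      then show "h z * (z - z0) powi (int m - 1 - int n) = 0"
        using h(3)[OF z] u(1) v(1) by (simp add: meromorphic_solution_def)
    qed
    then have "fuchs_seq a m 1 (residue u z0) n = 0"
      using h(2) g(2,6) by auto
    then show False using gen g(1) U(4) unfolding generic_coeffs_def by auto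
  qed
  then have eq: "U z = V z" if "z \<in> ball z0 \<rho>" for z
    using that \<rho>(1) U(3) V(3) res unfolding constant_on_def
    by (metis centre_in_ball eq_iff_diff_eq_0)
  have punctured: "u z = v z" if "z \<in> ball z0 \<rho> - {z0}" for z
  proof -
    have "z \<in> ball z0 \<rho>1 - {z0}" "z \<in> ball z0 \<rho>2 - {z0}" using that \<rho> by blast+
    then show ?thesis using U(5) V(4) eq that by simp
  qed
  have "eventually (\<lambda>z. u z = v z) (at z0)"
    using eventually_at_ball'[OF \<rho>(1), of z0 UNIV]
    by eventually_elim (use punctured in auto)
  then show ?thesis
    using nicely_meromorphic_identity u(1) v(1) meromorphic_solution_nicely by blast
qed

text \<open>The equation is autonomous, so the translate by q - p is again a solution. It has a pole
  at p with the residue of u at q, and uniqueness identifies it with u.\<close>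

lemma solution_period:
  assumes gen: "generic_coeffs n a" and u: "meromorphic_solution n a b \<alpha> u"
    and p: "is_pole u p" and q: "is_pole u q" and res: "residue u p = residue u q"
  shows "u (z + (q - p)) = u z"
proof -
  have "is_pole (\<lambda>z. u (z + (q - p))) p"
    using q is_pole_shift_iff[of u "q - p" p] by (simp add: o_def add_ac)
  moreover have "residue (\<lambda>z. u (z + (q - p))) p = residue u q"
    using residue_shift_0[of u q] residue_shift_0[of "\<lambda>z. u (z + (q - p))" p] by (simp add: add_ac)
  ultimately have "(\<lambda>z. u (z + (q - p))) = u"
    using solution_unique_by_residue[OF gen meromorphic_solution_shift[OF u] _ u p] res by metis
  from fun_cong[OF this, of z] show ?thesis .
qed

section \<open>Growth away from the poles\<close>

text \<open>Take w maximising |f| times the distance d to the boundary circle. The small disc has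
  radius at most d / 2, so on it the distance stays at least d / 2 and |f| can at most
  double.\<close>

lemma doubling_point:
  fixes f :: "'a :: heine_borel \<Rightarrow> 'b :: real_normed_vector"
  assumes "continuous_on (cball z0 R) f" "R > 0" "K > 0" "2 * K \<le> norm (f z0) * R"
  obtains w where "norm (f w) \<ge> norm (f z0)" "cball w (K / norm (f w)) \<subseteq> cball z0 R"
    "\<And>z. z \<in> cball w (K / norm (f w)) \<Longrightarrow> norm (f z) \<le> 2 * norm (f w)"
proof -
  define \<phi> where "\<phi> z = norm (f z) * (R - dist z0 z)" for z
  have "continuous_on (cball z0 R) \<phi>"
    unfolding \<phi>_def by (intro continuous_intros assms(1))
  then obtain w where w: "w \<in> cball z0 R" "\<And>z. z \<in> cball z0 R \<Longrightarrow> \<phi> z \<le> \<phi> w"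
    using continuous_attains_sup[of "cball z0 R" \<phi>] assms(2) by auto
  define d where "d = R - dist z0 w"
  have \<phi>w: "norm (f z0) * R \<le> norm (f w) * d"
    using w(2)[of z0] assms(2) by (simp add: \<phi>_def d_def)
  then have pos: "0 < norm (f w) * d" using assms(3,4) by linarith
  have d: "0 < d" "d \<le> R" "0 < norm (f w)"
    using pos w(1) by (auto simp: d_def zero_less_mult_iff)
  have half: "K / norm (f w) \<le> d / 2"
    using d(3) \<phi>w assms(4) by (simp add: field_simps)
  show ?thesis
  proof
    have "norm (f z0) * d \<le> norm (f w) * d"
      using \<phi>w d(2) by (meson mult_left_mono norm_ge_zero order_trans)
    then show "norm (f z0) \<le> norm (f w)" using d(1) by simp
    fix z assume z: "z \<in> cball w (K / norm (f w))"
    have "dist z0 z \<le> dist z0 w + dist w z" by (rule dist_triangle)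
    moreover have "dist w z \<le> d / 2" using z half by (metis mem_cball order_trans)
    ultimately have dz: "d / 2 \<le> R - dist z0 z" unfolding d_def by argo
    then have "z \<in> cball z0 R" using d(1) by simp
    then have "norm (f z) * (R - dist z0 z) \<le> norm (f w) * d"
      using w(2) by (auto simp: \<phi>_def d_def)
    moreover have "norm (f z) * (d / 2) \<le> norm (f z) * (R - dist z0 z)"
      using dz by (intro mult_left_mono) auto
    ultimately have "norm (f z) * d \<le> (2 * norm (f w)) * d" by (simp add: field_simps)
    then show "norm (f z) \<le> 2 * norm (f w)" using d(1) by simp
  next
    show "cball w (K / norm (f w)) \<subseteq> cball z0 R"
    proof
      fix z assume "z \<in> cball w (K / norm (f w))"
      then have "dist w z \<le> d / 2" using half by (metis mem_cball order_trans)
      then show "z \<in> cball z0 R"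
        using d(1) dist_triangle[of z0 z w] unfolding d_def mem_cball by argo
    qed
  qed
qed

text \<open>On a disc of radius \<open>K / M\<close> on which \<open>u = O(M)\<close> the derivatives lose a factor \<open>K\<close> against the
  products, by Cauchy's inequality.\<close>

lemma factor_product_approx:
  "\<exists>C\<ge>0. \<forall>u w M K. M \<ge> 1 \<longrightarrow> K \<ge> 1 \<longrightarrow> u holomorphic_on ball w (K / M) \<longrightarrow>
     (\<forall>z\<in>ball w (K / M). norm (u z) \<le> 2 * M) \<longrightarrow>
     factor_product a b u k (\<lambda>w. u w - \<alpha>) holomorphic_on ball w (K / M) \<and>
     (\<forall>z\<in>ball w (K / M / 2 ^ k).
        norm (factor_product a b u k (\<lambda>w. u w - \<alpha>) z) \<le> C * M ^ Suc k \<and>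
        norm (factor_product a b u k (\<lambda>w. u w - \<alpha>) z
          - (u z - \<alpha>) * (\<Prod>j=1..k. - (a j * u z + b j))) \<le> C * M ^ Suc k / K)"
proof (induction k)
  case 0
  have "norm (u z - \<alpha>) \<le> (2 + norm \<alpha>) * M" if "M \<ge> 1" "norm (u z) \<le> 2 * M" for u :: "complex \<Rightarrow> complex" and M z
  proof -
    have "norm \<alpha> * 1 \<le> norm \<alpha> * M" using that(1) by (intro mult_left_mono) auto
    then show ?thesis using that(2) norm_triangle_ineq4[of "u z" \<alpha>] by (simp add: algebra_simps)
  qed
  then show ?case
    by (intro exI[of _ "2 + norm \<alpha>"]) (auto intro!: holomorphic_intros)
next
  case (Suc k)
  then obtain C where "C \<ge> 0" and IH:
    "\<And>u w M K. \<lbrakk>M \<ge> 1; K \<ge> 1; u holomorphic_on ball w (K / M);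
       \<And>z. z \<in> ball w (K / M) \<Longrightarrow> norm (u z) \<le> 2 * M\<rbrakk> \<Longrightarrow>
     factor_product a b u k (\<lambda>w. u w - \<alpha>) holomorphic_on ball w (K / M) \<and>
     (\<forall>z\<in>ball w (K / M / 2 ^ k).
        norm (factor_product a b u k (\<lambda>w. u w - \<alpha>) z) \<le> C * M ^ Suc k \<and>
        norm (factor_product a b u k (\<lambda>w. u w - \<alpha>) z
          - (u z - \<alpha>) * (\<Prod>j=1..k. - (a j * u z + b j))) \<le> C * M ^ Suc k / K)"
    by blast
  let ?a = "a (Suc k)" and ?b = "b (Suc k)"
  \<comment> \<open>The power of 2 is the price of Cauchy's inequality with radius \<open>s\<close>;
    the rest bounds the linear factor, using that |u| is at most 2 M and M \<ge> 1.\<close>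
  define C' where "C' = (2 ^ (k + 2) + 2 * norm ?a + norm ?b) * C"
  show ?case
  proof (intro exI[of _ C'] conjI allI impI ballI)
    show "C' \<ge> 0" using \<open>C \<ge> 0\<close> by (simp add: C'_def)
    fix u :: "complex \<Rightarrow> complex" and w :: complex and M K :: real
    assume M: "M \<ge> 1" and K: "K \<ge> 1" and u: "u holomorphic_on ball w (K / M)"
      and ub: "\<forall>z\<in>ball w (K / M). norm (u z) \<le> 2 * M"
    define F where "F = factor_product a b u k (\<lambda>w. u w - \<alpha>)"
    define P where "P z = (u z - \<alpha>) * (\<Prod>j=1..k. - (a j * u z + b j))" for z
    have F: "F holomorphic_on ball w (K / M)"
      "\<And>z. z \<in> ball w (K / M / 2 ^ k) \<Longrightarrow> norm (F z) \<le> C * M ^ Suc k"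
      "\<And>z. z \<in> ball w (K / M / 2 ^ k) \<Longrightarrow> norm (F z - P z) \<le> C * M ^ Suc k / K"
      using IH[OF M K u] ub unfolding F_def P_def by blast+
    have FS: "factor_product a b u (Suc k) (\<lambda>w. u w - \<alpha>) = (\<lambda>z. deriv F z - (?a * u z + ?b) * F z)"
      by (simp add: F_def D_minus_def)
    show "factor_product a b u (Suc k) (\<lambda>w. u w - \<alpha>) holomorphic_on ball w (K / M)"
      unfolding FS by (intro holomorphic_intros F(1) u) auto
    fix z assume z: "z \<in> ball w (K / M / 2 ^ Suc k)"
    have "K / M > 0" using M K by simp
    \<comment> \<open>A quarter of the radius at level k: around a point of the halved disc, the
      closed disc of radius \<open>s\<close> stays inside the open disc on which F is already
      bounded.\<close>
    define s where "s = K / M / 2 ^ (k + 2)"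
    have s: "s > 0" "K / M / 2 ^ Suc k + s \<le> K / M / 2 ^ k" "K / M / 2 ^ k \<le> K / M"
    proof -
      have "0 < t / 2 ^ (k + 2) \<and> t / 2 ^ Suc k + t / 2 ^ (k + 2) \<le> t / 2 ^ k \<and> t / 2 ^ k \<le> t"
        if "t > 0" for t :: real
        using that by (auto simp: field_simps)
      from this[OF \<open>K / M > 0\<close>]
      show "s > 0" "K / M / 2 ^ Suc k + s \<le> K / M / 2 ^ k" "K / M / 2 ^ k \<le> K / M"
        unfolding s_def by blast+
    qed
    have sub: "cball z s \<subseteq> ball w (K / M / 2 ^ k)"
    proof
      fix y assume "y \<in> cball z s"
      then show "y \<in> ball w (K / M / 2 ^ k)"
        using z s dist_triangle[of w y z] by simp
    qed
    have sub': "ball w (K / M / 2 ^ k) \<subseteq> ball w (K / M)"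
      using s(3) by (rule subset_ball)
    have zin: "z \<in> ball w (K / M / 2 ^ k)"
      using sub s(1) by (meson centre_in_cball less_imp_le subsetD)
    have "norm ((deriv ^^ 1) F z) \<le> fact 1 * (C * M ^ Suc k) / s ^ 1"
    proof (rule Cauchy_inequality)
      show "F holomorphic_on ball z s" "continuous_on (cball z s) F"
        using F(1) sub sub' ball_subset_cball holomorphic_on_subset holomorphic_on_imp_continuous_on
        by (meson order_trans)+
      show "norm (F x) \<le> C * M ^ Suc k" if "norm (z - x) = s" for x
        using F(2)[of x] sub that by (auto simp: subset_iff dist_norm)
    qed (use s in auto)
    then have "norm (deriv F z) \<le> C * M ^ Suc k / s" by simp
    also have "\<dots> = 2 ^ (k + 2) * C * M ^ Suc (Suc k) / K"
      using M K by (simp add: s_def field_simps)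
    finally have dF: "norm (deriv F z) \<le> 2 ^ (k + 2) * C * M ^ Suc (Suc k) / K" .
    have lin: "norm (?a * u z + ?b) \<le> (2 * norm ?a + norm ?b) * M"
    proof -
      have "norm (?a * u z + ?b) \<le> norm ?a * norm (u z) + norm ?b"
        by (metis norm_mult norm_triangle_ineq)
      also have "\<dots> \<le> norm ?a * (2 * M) + norm ?b * M"
        using M ub zin sub' by (intro add_mono mult_left_mono) (auto simp: mult_le_cancel_left1)
      finally show ?thesis by (simp add: algebra_simps)
    qed
    have prod: "norm ((?a * u z + ?b) * y) \<le> (2 * norm ?a + norm ?b) * M * B" if "norm y \<le> B" for y B
      unfolding norm_mult using that lin M by (intro mult_mono) auto
    have "norm (deriv F z - (?a * u z + ?b) * F z) \<le>
        2 ^ (k + 2) * C * M ^ Suc (Suc k) / K + (2 * norm ?a + norm ?b) * M * (C * M ^ Suc k)"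
      using norm_triangle_ineq4 dF prod[OF F(2)[OF zin]] by (meson add_mono order_trans)
    also have "2 ^ (k + 2) * C * M ^ Suc (Suc k) / K \<le> 2 ^ (k + 2) * C * M ^ Suc (Suc k) / 1"
      using M K \<open>C \<ge> 0\<close> by (intro divide_left_mono) auto
    finally show "norm (factor_product a b u (Suc k) (\<lambda>w. u w - \<alpha>) z) \<le> C' * M ^ Suc (Suc k)"
      unfolding FS C'_def by (simp add: algebra_simps)
    have "deriv F z - (?a * u z + ?b) * F z - (u z - \<alpha>) * (\<Prod>j=1..Suc k. - (a j * u z + b j)) =
        deriv F z - (?a * u z + ?b) * (F z - P z)"
      by (simp add: P_def algebra_simps)
    also have "norm \<dots> \<le>
        2 ^ (k + 2) * C * M ^ Suc (Suc k) / K + (2 * norm ?a + norm ?b) * M * (C * M ^ Suc k / K)"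
      using norm_triangle_ineq4 dF prod[OF F(3)[OF zin]] by (meson add_mono order_trans)
    also have "\<dots> = C' * M ^ Suc (Suc k) / K"
      using K by (simp add: C'_def field_simps)
    finally show "norm (factor_product a b u (Suc k) (\<lambda>w. u w - \<alpha>) z
        - (u z - \<alpha>) * (\<Prod>j=1..Suc k. - (a j * u z + b j))) \<le> C' * M ^ Suc (Suc k) / K"
      unfolding FS .
  qed
qed

lemma solution_growth:
  assumes sol: "meromorphic_solution n a b \<alpha> u" and a: "\<And>j. j \<in> {1..n} \<Longrightarrow> a j \<noteq> 0"
  obtains C where "C \<ge> 1"
    "\<And>z R. R > 0 \<Longrightarrow> (\<And>p. p \<in> cball z R \<Longrightarrow> \<not> is_pole u p) \<Longrightarrow> norm (u z) \<le> C * max 1 (1 / R)"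
proof -
  from factor_product_approx[of a b n \<alpha>] obtain C where "C \<ge> 0" and approx:
    "\<And>u w M K. \<lbrakk>M \<ge> 1; K \<ge> 1; u holomorphic_on ball w (K / M);
       \<And>z. z \<in> ball w (K / M) \<Longrightarrow> norm (u z) \<le> 2 * M\<rbrakk> \<Longrightarrow>
     (\<forall>z\<in>ball w (K / M / 2 ^ n). norm (factor_product a b u n (\<lambda>w. u w - \<alpha>) z
          - (u z - \<alpha>) * (\<Prod>j=1..n. - (a j * u z + b j))) \<le> C * M ^ Suc n / K)"
    by blast
  \<comment> \<open>\<open>C\<close> was obtained before \<open>K\<close>, so \<open>K\<close> may
    depend on it. Where |u| = M \<ge> M0, each |a_j u + b_j| is at least |a_j| M / 2 and |u -
    \<alpha>| at least M / 2, so the product is at least c0 M^(n+1). The choice of \<open>K\<close>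
    gives c0 K = C + c0 > C, so an error of C M^(n+1) / K cannot balance it.\<close>
  define c0 where "c0 = (\<Prod>j=1..n. norm (a j) / 2) / 2"
  have c0: "c0 > 0" unfolding c0_def using a by (auto intro!: prod_pos)
  define K where "K = C / c0 + 1"
  have K: "K \<ge> 1" using \<open>C \<ge> 0\<close> c0 by (simp add: K_def)
  define M0 where "M0 = 1 + 2 * norm \<alpha> + (\<Sum>j=1..n. 2 * norm (b j) / norm (a j))"
  have sum_nn: "0 \<le> (\<Sum>j=1..n. 2 * norm (b j) / norm (a j))" by (intro sum_nonneg) auto
  have M0: "M0 \<ge> 1" "M0 \<ge> 2 * norm \<alpha>"
    using sum_nn unfolding M0_def by (smt (verit) norm_ge_zero)+
  have M0b: "2 * norm (b j) / norm (a j) \<le> M0" if "j \<in> {1..n}" for j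
  proof -
    have "2 * norm (b j) / norm (a j) \<le> (\<Sum>j=1..n. 2 * norm (b j) / norm (a j))"
      by (rule member_le_sum) (use that in auto)
    also have "\<dots> \<le> M0" by (simp add: M0_def)
    finally show ?thesis .
  qed
  \<comment> \<open>A violation of the bound at z then forces M0 \<le> |u z| and 2 K \<le> |u z| R,
    the latter being the input of \<open>doubling_point\<close>.\<close>
  define B where "B = max M0 (2 * K)"
  show ?thesis
  proof
    show "B \<ge> 1" using M0 by (simp add: B_def)
    fix z :: complex and R :: real
    assume R: "R > 0" and nopole: "\<And>p. p \<in> cball z R \<Longrightarrow> \<not> is_pole u p"
    show "norm (u z) \<le> B * max 1 (1 / R)"
    proof (rule ccontr)
      assume "\<not> norm (u z) \<le> B * max 1 (1 / R)"
      then have big: "B * max 1 (1 / R) < norm (u z)" by simp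
      have "B * 1 \<le> B * max 1 (1 / R)" "B * (1 / R) \<le> B * max 1 (1 / R)"
        using \<open>B \<ge> 1\<close> by (intro mult_left_mono; simp)+
      then have uz: "M0 \<le> norm (u z)" "2 * K / R \<le> norm (u z)"
        using big R unfolding B_def by (auto intro: order_trans) (smt (verit) divide_right_mono)
      have hol: "u holomorphic_on cball z R"
        by (rule nicely_meromorphic_holomorphic_off_poles[OF meromorphic_solution_nicely[OF sol] nopole])
      obtain w where w: "norm (u z) \<le> norm (u w)" "cball w (K / norm (u w)) \<subseteq> cball z R"
        "\<And>y. y \<in> cball w (K / norm (u w)) \<Longrightarrow> norm (u y) \<le> 2 * norm (u w)"
        using doubling_point[OF holomorphic_on_imp_continuous_on[OF hol] R, of K] uz(2) K R
        by (auto simp: field_simps)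
      define M where "M = norm (u w)"
      have M: "M \<ge> M0" "M \<ge> 1" using uz(1) w(1) M0 by (auto simp: M_def)
      have pos: "K / M > 0" using K M by simp
      have "w \<in> cball z R" using w(2) pos unfolding M_def by (meson centre_in_cball less_imp_le subsetD)
      then have "\<not> is_pole u w" by (rule nopole)
      then have zero: "factor_product a b u n (\<lambda>w. u w - \<alpha>) w = 0"
        using sol by (simp add: meromorphic_solution_def)
      have sub: "ball w (K / M) \<subseteq> cball w (K / norm (u w))"
        unfolding M_def by (rule ball_subset_cball)
      have "u holomorphic_on ball w (K / M)"
        using hol w(2) sub holomorphic_on_subset by blast
      moreover have "norm (u y) \<le> 2 * M" if "y \<in> ball w (K / M)" for y
        using w(3) sub that unfolding M_def by blast
      moreover have "w \<in> ball w (K / M / 2 ^ n)"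
        unfolding centre_in_ball using pos by (rule divide_pos_pos) simp
      ultimately have "norm (0 - (u w - \<alpha>) * (\<Prod>j=1..n. - (a j * u w + b j))) \<le> C * M ^ Suc n / K"
        using approx[OF M(2) K, of u w] unfolding zero[symmetric] by blast
      then have upper: "norm ((u w - \<alpha>) * (\<Prod>j=1..n. - (a j * u w + b j))) \<le> C * M ^ Suc n / K"
        by (simp only: diff_0 norm_minus_cancel)
      have "norm (u w) - norm \<alpha> \<le> norm (u w - \<alpha>)" by (rule norm_triangle_ineq2)
      then have "M / 2 \<le> norm (u w - \<alpha>)" using M0(2) M(1) by (simp add: M_def)
      moreover have "(\<Prod>j=1..n. norm (a j) / 2 * M) \<le> (\<Prod>j=1..n. norm (- (a j * u w + b j)))"
      proof (rule prod_mono, intro conjI)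
        fix j assume j: "j \<in> {1..n}"
        show "0 \<le> norm (a j) / 2 * M" using M by simp
        have "2 * norm (b j) \<le> M * norm (a j)"
          using M0b[OF j] M(1) a[OF j] by (simp add: field_simps) (smt (verit) mult_right_mono norm_ge_zero)
        moreover have "norm (a j * u w) - norm (b j) \<le> norm (a j * u w + b j)"
          by (rule norm_diff_ineq)
        ultimately show "norm (a j) / 2 * M \<le> norm (- (a j * u w + b j))"
          unfolding norm_minus_cancel norm_mult M_def[symmetric] by (simp add: mult.commute)
      qed
      moreover have "(\<Prod>j=1..n. norm (a j) / 2 * M) = (\<Prod>j=1..n. norm (a j) / 2) * M ^ n"
        by (simp only: prod.distrib prod_constant card_atLeastAtMost diff_Suc_1)
      ultimately have "M / 2 * ((\<Prod>j=1..n. norm (a j) / 2) * M ^ n) \<le>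
          norm (u w - \<alpha>) * (\<Prod>j=1..n. norm (- (a j * u w + b j)))"
        using M by (intro mult_mono) (auto intro!: mult_nonneg_nonneg prod_nonneg)
      also have "\<dots> = norm ((u w - \<alpha>) * (\<Prod>j=1..n. - (a j * u w + b j)))"
        by (simp only: norm_mult prod_norm)
      also note upper
      finally have "c0 * M ^ Suc n \<le> C * M ^ Suc n / K"
        by (simp add: c0_def mult_ac)
      then have "(c0 * K) * M ^ Suc n \<le> C * M ^ Suc n" using K by (simp add: field_simps)
      then have "c0 * K \<le> C" using M by (simp only: mult_le_cancel_right) auto
      moreover have "c0 * K = C + c0" using c0 by (simp add: K_def distrib_left)
      ultimately show False using c0 by linarith
    qed
  qed
qed

section \<open>Membership in the class W\<close>

lemma partial_fraction_as_quotient: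
  fixes d e :: "'i \<Rightarrow> complex"
  assumes "finite S"
  shows "\<exists>P Q :: complex poly. Q \<noteq> 0 \<and>
    (\<forall>x. x \<notin> e ` S \<longrightarrow> poly Q x \<noteq> 0 \<and> c + (\<Sum>i\<in>S. d i / (x - e i)) = poly P x / poly Q x)"
  using assms
proof (induction S rule: finite_induct)
  case empty
  show ?case by (rule exI[of _ "[:c:]"], rule exI[of _ 1]) auto
next
  case (insert i S)
  then obtain P Q :: "complex poly" where PQ: "Q \<noteq> 0"
    "\<And>x. x \<notin> e ` S \<Longrightarrow> poly Q x \<noteq> 0 \<and> c + (\<Sum>i\<in>S. d i / (x - e i)) = poly P x / poly Q x"
    by blast
  show ?case
  proof (intro exI conjI allI impI)
    show "Q * [:- e i, 1:] \<noteq> 0" using PQ(1) by (metis mult_eq_0_iff pCons_eq_0_iff one_neq_zero)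
    fix x assume x: "x \<notin> e ` insert i S"
    then show "poly (Q * [:- e i, 1:]) x \<noteq> 0" using PQ(2)[of x] by auto
    have "c + (\<Sum>i\<in>insert i S. d i / (x - e i)) = (c + (\<Sum>i\<in>S. d i / (x - e i))) + d i / (x - e i)"
      using insert.hyps by simp
    also have "\<dots> = poly P x / poly Q x + d i / (x - e i)" using PQ(2)[of x] x by simp
    also have "\<dots> = poly (P * [:- e i, 1:] + smult (d i) Q) x / poly (Q * [:- e i, 1:]) x"
      using x PQ(2)[of x] by (simp add: divide_simps algebra_simps)
    finally show "c + (\<Sum>i\<in>insert i S. d i / (x - e i)) = \<dots>" .
  qed
qed

text \<open>\<open>rational_fun\<close> asks for coprime polynomials. Splitting off a common divisor
  that is not a unit lowers the degree of the denominator, so this terminates.\<close>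

lemma fraction_in_lowest_terms:
  fixes P Q :: "'a :: field poly"
  assumes "Q \<noteq> 0"
  shows "\<exists>P' Q' g. P = P' * g \<and> Q = Q' * g \<and> coprime P' Q'"
  using assms
proof (induction "degree Q" arbitrary: P Q rule: less_induct)
  case less
  show ?case
  proof (cases "coprime P Q")
    case True
    then show ?thesis by (intro exI[of _ P] exI[of _ Q] exI[of _ 1]) simp
  next
    case False
    then obtain h where h: "h dvd P" "h dvd Q" "\<not> is_unit h" by (rule not_coprimeE)
    then obtain p q where pq: "P = h * p" "Q = h * q" by (auto elim!: dvdE)
    have nz: "h \<noteq> 0" "q \<noteq> 0" using pq(2) less.prems by auto
    have "degree h > 0" using h(3) nz(1) is_unit_iff_degree by blast
    then have "degree q < degree Q" unfolding pq(2) using nz by (simp add: degree_mult_eq)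
    from less.hyps[OF this nz(2)] obtain P' Q' g where
      "p = P' * g" "q = Q' * g" "coprime P' Q'" by blast
    then show ?thesis
      unfolding pq by (intro exI[of _ P'] exI[of _ Q'] exI[of _ "h * g"]) (simp add: mult_ac)
  qed
qed

text \<open>Near p, g z - g p behaves like g'(p) (z - p), so the subtracted fraction has residue
  \<open>U p\<close> and serves as principal part in the variable g.\<close>

lemma simple_pole_difference_limit:
  assumes \<rho>: "\<rho> > 0" and U: "U holomorphic_on ball p \<rho>"
    and u: "\<And>z. z \<in> ball p \<rho> - {p} \<Longrightarrow> u z = U z * (z - p) powi (-1)"
    and g: "g holomorphic_on UNIV" "deriv g p \<noteq> 0"
  shows "((\<lambda>z. (z - p) * (u z - U p * deriv g p / (g z - g p))) \<longlongrightarrow> 0) (at p)"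
proof -
  have "isCont U p" using holomorphic_on_imp_continuous_on[OF U] \<rho>
    by (simp add: continuous_on_eq_continuous_at)
  then have "(U \<longlongrightarrow> U p) (at p)" by (simp add: isCont_def)
  moreover have "((\<lambda>z. (g z - g p) / (z - p)) \<longlongrightarrow> deriv g p) (at p)"
    using holomorphic_derivI[OF g(1) open_UNIV, of p] unfolding has_field_derivative_iff by simp
  ultimately have "((\<lambda>z. U z - U p * deriv g p * inverse ((g z - g p) / (z - p))) \<longlongrightarrow>
      U p - U p * deriv g p * inverse (deriv g p)) (at p)"
    using g(2) by (intro tendsto_intros)
  moreover have "eventually (\<lambda>z. U z - U p * deriv g p * inverse ((g z - g p) / (z - p)) =
      (z - p) * (u z - U p * deriv g p / (g z - g p))) (at p)"
    using eventually_at_ball'[OF \<rho>, of p UNIV]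
  proof eventually_elim
    case (elim z)
    then have uz: "(z - p) * u z = U z" using u[of z] by (simp add: power_int_minus)
    have "(z - p) * (u z - U p * deriv g p / (g z - g p)) =
        (z - p) * u z - U p * deriv g p * ((z - p) / (g z - g p))"
      by (simp only: right_diff_distrib times_divide_eq_right mult_ac)
    then show ?case by (simp only: uz inverse_divide)
  qed
  ultimately show ?thesis using g(2) tendsto_cong by (fastforce simp: field_simps)
qed

lemma meromorphic_no_pole_of_limit:
  assumes "h meromorphic_on UNIV" "((\<lambda>z. (z - p) * h z) \<longlongrightarrow> 0) (at p)"
  shows "\<not> is_pole h p"
proof -
  have "isolated_singularity_at h p"
    using assms(1) by (meson UNIV_I meromorphic_on_isolated_singularity meromorphic_on_subset subset_UNIV)
  then obtain r where r: "r > 0" "h analytic_on ball p r - {p}"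
    unfolding isolated_singularity_at_def by blast
  then have "h holomorphic_on ball p r - {p}" using analytic_imp_holomorphic by blast
  from holomorphic_on_extend_lim[OF this] assms(2) r(1) obtain g where
    g: "g holomorphic_on ball p r" "\<And>z. z \<in> ball p r - {p} \<Longrightarrow> g z = h z"
    by (auto simp: interior_open)
  have "eventually (\<lambda>z. h z = g z) (at p)"
    using eventually_at_ball'[OF r(1), of p UNIV] by eventually_elim (use g(2) in auto)
  then have "is_pole h p = is_pole g p" by (rule is_pole_cong) simp
  then show ?thesis using not_is_pole_holomorphic[OF open_ball _ g(1)] r(1) by simp
qed

text \<open>The difference of \<open>u\<close> and the sum of its principal parts in \<open>g\<close> extends to a bounded entire
  function.\<close>

lemma rational_of_factor:
  assumes nice: "u nicely_meromorphic_on UNIV" and g: "g holomorphic_on UNIV"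
    and simple: "\<And>p. is_pole u p \<Longrightarrow> \<exists>\<rho> U. \<rho> > 0 \<and> U holomorphic_on ball p \<rho> \<and>
      (\<forall>z\<in>ball p \<rho> - {p}. u z = U z * (z - p) powi (-1))"
    and S: "finite S" "\<And>p. p \<in> S \<Longrightarrow> is_pole u p \<and> deriv g p \<noteq> 0" "inj_on g S"
    and poles: "\<And>z. is_pole u z \<Longrightarrow> \<exists>p\<in>S. g z = g p"
    and period: "\<And>z p w. g z = g p \<Longrightarrow> u (w + (z - p)) = u w \<and> g (w + (z - p)) = g w"
    and K: "compact K" and \<delta>: "\<delta> > 0"
    and cover: "\<And>z. (\<exists>z'\<in>K. g z' = g z) \<or>
      (norm (u z) \<le> B \<and> \<not> is_pole u z \<and> (\<forall>p\<in>S. \<delta> \<le> norm (g z - g p)))"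
  obtains R where "rational_fun R" "\<And>z. u z = R (g z)"
proof -
  from simple S(2) obtain c where
    c: "\<And>p. p \<in> S \<Longrightarrow> ((\<lambda>z. (z - p) * (u z - c p * deriv g p / (g z - g p))) \<longlongrightarrow> 0) (at p)"
  proof -
    have "\<forall>p\<in>S. \<exists>c. ((\<lambda>z. (z - p) * (u z - c * deriv g p / (g z - g p))) \<longlongrightarrow> 0) (at p)"
    proof
      fix p assume p: "p \<in> S"
      with simple S(2) obtain \<rho> U where "\<rho> > 0" "U holomorphic_on ball p \<rho>"
        "\<And>z. z \<in> ball p \<rho> - {p} \<Longrightarrow> u z = U z * (z - p) powi (-1)" by metis
      from simple_pole_difference_limit[OF this g] S(2)[OF p]
      show "\<exists>c. ((\<lambda>z. (z - p) * (u z - c * deriv g p / (g z - g p))) \<longlongrightarrow> 0) (at p)" by blast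
    qed
    then show ?thesis using that by metis
  qed
  define d where "d p = c p * deriv g p" for p
  define h where "h z = u z - (\<Sum>p\<in>S. d p / (g z - g p))" for z
  have g_ana: "g analytic_on UNIV" using g by (simp add: analytic_on_open)
  have u_mero: "u meromorphic_on UNIV" using nice by (simp add: nicely_meromorphic_on_def)
  have h_mero: "h meromorphic_on UNIV"
    unfolding h_def
    by (intro meromorphic_intros u_mero analytic_on_imp_meromorphic_on[OF g_ana])
  have iso: "isolated_singularity_at h z" for z
    using h_mero by (meson UNIV_I meromorphic_on_isolated_singularity meromorphic_on_subset subset_UNIV)
  have pole_g: "is_pole u z" if "p \<in> S" "g z = g p" for z p
  proof -
    have "(\<lambda>w. u (w + (z - p))) = u" using period[OF that(2)] by auto
    then show ?thesis
      using S(2)[OF that(1)] is_pole_shift_iff[of u "z - p" p] by (simp add: o_def add_ac)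
  qed
  have h_ana: "h analytic_on {z}" if "\<not> is_pole u z" for z
    unfolding h_def using that pole_g
    by (intro analytic_intros nicely_meromorphic_on_imp_analytic_at[OF nice] analytic_on_subset[OF g_ana])
       auto
  have h_period: "h (w + (z - p)) = h w" if "g z = g p" for z p w
    using period[OF that] by (simp add: h_def)
  have lim0: "((\<lambda>z. (z - p) * h z) \<longlongrightarrow> 0) (at p)" if p: "p \<in> S" for p
  proof -
    \<comment> \<open>Only the summand at p is singular there: g is injective on S, so the others
      are continuous at p and are killed by the factor z - p.\<close>
    have "((\<lambda>z. (z - p) * (\<Sum>q\<in>S - {p}. d q / (g z - g q))) \<longlongrightarrow> (p - p) * (\<Sum>q\<in>S - {p}. d q / (g p - g q))) (at p)"
    proof (intro tendsto_intros)
      show "(g \<longlongrightarrow> g p) (at p)"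
        using holomorphic_on_imp_continuous_on[OF g] by (simp add: continuous_on_eq_continuous_at isCont_def)
      show "g p - g q \<noteq> 0" if "q \<in> S - {p}" for q
        using that S(3) p by (auto simp: inj_on_def)
    qed
    from tendsto_diff[OF c[OF p] this]
    show ?thesis
      by (simp add: h_def d_def sum.remove[OF S(1) p] algebra_simps)
  qed
  have no_pole: "\<not> is_pole h z" for z
  proof (cases "is_pole u z")
    case True
    then obtain p where p: "p \<in> S" "g z = g p" using poles by blast
    have "(\<lambda>w. h (w + (z - p))) = h" using h_period[OF p(2)] by auto
    then have "is_pole h z = is_pole h p"
      using is_pole_shift_iff[of h "z - p" p] by (simp add: o_def add_ac)
    then show ?thesis using meromorphic_no_pole_of_limit[OF h_mero lim0[OF p(1)]] by simp
  qed (use h_ana analytic_at_imp_no_pole in blast)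
  define H where "H = remove_sings h"
  have H_nice: "H nicely_meromorphic_on UNIV"
    unfolding H_def by (rule remove_sings_nicely_meromorphic[OF h_mero])
  have "H analytic_on UNIV"
    by (rule nicely_meromorphic_without_singularities[OF H_nice])
       (use no_pole is_pole_remove_sings_iff[OF iso] in \<open>auto simp: H_def\<close>)
  then have H_hol: "H holomorphic_on UNIV" by (simp add: analytic_on_open)
  have H_period: "H z = H p" if "g z = g p" for z p
  proof -
    have "eventually (\<lambda>w. H (w + (z - p)) = H w) (at p)"
    proof -
      have "eventually (\<lambda>w. H w = h w) (at p)"
        unfolding H_def by (rule eventually_remove_sings_eq_at[OF iso])
      moreover have "eventually (\<lambda>w. H (w + (z - p)) = h (w + (z - p))) (at p)"
        using eventually_remove_sings_eq_at[OF iso, of z] unfolding H_def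
        by (simp add: at_to_0[of z] at_to_0[of p] eventually_filtermap add_ac)
      ultimately show ?thesis by eventually_elim (simp add: h_period[OF that])
    qed
    then have "(\<lambda>w. H (w + (z - p))) = H"
      using nicely_meromorphic_identity[OF nicely_meromorphic_shift[OF H_nice] H_nice] by blast
    from fun_cong[OF this, of p] show ?thesis by simp
  qed
  have "bounded (H ` K)"
    using compact_continuous_image[OF continuous_on_subset[OF holomorphic_on_imp_continuous_on[OF H_hol]] K]
    by (simp add: compact_imp_bounded)
  then obtain B1 where B1: "\<And>z. z \<in> K \<Longrightarrow> norm (H z) \<le> B1" unfolding bounded_iff by auto
  \<comment> \<open>If the value g z is attained on the compact set, periodicity transfers the bound
    from there. Elsewhere u is bounded and the denominators of the principal parts are at least
    \<delta>.\<close>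
  have "norm (H z) \<le> max B1 (B + (\<Sum>p\<in>S. norm (d p) / \<delta>))" for z
  proof (cases "\<exists>z'\<in>K. g z' = g z")
    case True
    then show ?thesis using H_period B1 by (metis max.coboundedI1)
  next
    case False
    with cover[of z] have z: "norm (u z) \<le> B" "\<not> is_pole u z" "\<And>p. p \<in> S \<Longrightarrow> \<delta> \<le> norm (g z - g p)"
      by auto
    have "H z = h z" unfolding H_def using remove_sings_at_analytic[OF h_ana[OF z(2)]] .
    also have "norm (h z) \<le> norm (u z) + (\<Sum>p\<in>S. norm (d p / (g z - g p)))"
      unfolding h_def by (rule order_trans[OF norm_triangle_ineq4]) (simp add: norm_sum)
    also have "\<dots> \<le> B + (\<Sum>p\<in>S. norm (d p) / \<delta>)"
      using z(1,3) \<delta> by (intro add_mono sum_mono) (auto simp: norm_divide intro!: divide_left_mono mult_pos_pos dest: less_le_trans)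
    finally show ?thesis by simp
  qed
  then have "bounded (range H)" unfolding bounded_iff by blast
  then obtain C where C: "\<And>z. H z = C"
    using Liouville_theorem[OF H_hol] unfolding constant_on_def by blast
  have u_eq: "u z = C + (\<Sum>p\<in>S. d p / (g z - g p))" if "\<not> is_pole u z" for z
    using C[of z] remove_sings_at_analytic[OF h_ana[OF that]] unfolding H_def h_def
    by (simp add: algebra_simps)
  obtain P Q :: "complex poly" where PQ: "Q \<noteq> 0"
    "\<And>x. x \<notin> g ` S \<Longrightarrow> poly Q x \<noteq> 0 \<and> C + (\<Sum>i\<in>S. d i / (x - g i)) = poly P x / poly Q x"
    using partial_fraction_as_quotient[OF S(1), of g C d] by blast
  obtain P' Q' h' where PQ': "P = P' * h'" "Q = Q' * h'" "coprime P' Q'"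
    using fraction_in_lowest_terms[OF PQ(1), of P] by blast
  have "Q' \<noteq> 0" using PQ(1) PQ'(2) by auto
  define R where "R x = poly P' x / poly Q' x" for x
  show ?thesis
  proof (rule that[of R])
    show "rational_fun R"
      unfolding rational_fun_def R_def using \<open>Q' \<noteq> 0\<close> PQ'(3) by blast
    have u_R: "u z = R (g z)" if "\<not> is_pole u z" for z
    proof -
      have "g z \<notin> g ` S" using pole_g that by blast
      then have Q: "poly Q (g z) \<noteq> 0" and "u z = poly P (g z) / poly Q (g z)"
        using PQ(2)[of "g z"] u_eq[OF that] by auto
      moreover have "poly P (g z) = poly P' (g z) * poly h' (g z)"
        "poly Q (g z) = poly Q' (g z) * poly h' (g z)"
        using PQ'(1,2) by (metis poly_mult)+
      ultimately show ?thesis unfolding R_def by auto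
    qed
    show "u z = R (g z)" for z
    proof (cases "is_pole u z")
      case True
      \<comment> \<open>Division by 0 has to reproduce the value 0 of u at its pole. If the
        denominator did not vanish, R composed with g would be continuous at z and u would have a
        finite limit there.\<close>
      have "poly Q' (g z) = 0"
      proof (rule ccontr)
        assume nz: "poly Q' (g z) \<noteq> 0"
        have "isCont g z"
          using holomorphic_on_imp_continuous_on[OF g] by (simp add: continuous_on_eq_continuous_at)
        then have "isCont (\<lambda>w. R (g w)) z"
          unfolding R_def using nz by (intro continuous_intros)
        then have lim: "((\<lambda>w. R (g w)) \<longlongrightarrow> R (g z)) (at z)" by (simp add: isCont_def)
        have "eventually (\<lambda>w. \<not> is_pole u w) (at z)"
          using nicely_meromorphic_isolated_poles[OF nice, of z]
          by (auto simp: islimpt_conv_frequently_at frequently_def)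
        then have "eventually (\<lambda>w. R (g w) = u w) (at z)"
          by eventually_elim (simp add: u_R)
        from tendsto_cong[OF this] lim have "(u \<longlongrightarrow> R (g z)) (at z)" by simp
        then show False
          using True unfolding is_pole_def
          by (meson at_neq_bot not_tendsto_and_filterlim_at_infinity)
      qed
      then show ?thesis using nicely_meromorphic_at_pole[OF nice True] by (simp add: R_def)
    qed (rule u_R)
  qed
qed

section \<open>Rational, simply periodic and elliptic solutions\<close>

lemma finite_poles_in_compact:
  assumes "u nicely_meromorphic_on UNIV" "compact K"
  shows "finite (K \<inter> {p. is_pole u p})"
  by (rule finite_not_islimpt_in_compact[OF assms(2)]) (rule nicely_meromorphic_isolated_poles[OF assms(1)])

context
  fixes n a b \<alpha> u
  assumes sol: "meromorphic_solution n a b \<alpha> u" and gen: "generic_coeffs n a"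
begin

lemma coeffs_nonzero: "j \<in> {1..n} \<Longrightarrow> a j \<noteq> 0"
  using gen by (simp add: generic_coeffs_def)

lemma solution_simple_pole:
  assumes "is_pole u p"
  shows "\<exists>\<rho> U. \<rho> > 0 \<and> U holomorphic_on ball p \<rho> \<and>
      (\<forall>z\<in>ball p \<rho> - {p}. u z = U z * (z - p) powi (-1))"
  by (rule solution_pole[OF sol coeffs_nonzero assms]) blast+

lemma solution_zorder_pole:
  assumes "is_pole u p"
  shows "zorder u p = -1"
  by (rule solution_pole[OF sol coeffs_nonzero assms])

lemma solution_finite_residues: "finite (residue u ` {p. is_pole u p})"
proof (rule finite_subset)
  show "residue u ` {p. is_pole u p} \<subseteq> (\<lambda>j. - of_nat j / a j) ` {1..n}"
  proof clarify
    fix p assume p: "is_pole u p"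
    show "residue u p \<in> (\<lambda>j. - of_nat j / a j) ` {1..n}"
      by (rule solution_pole[OF sol coeffs_nonzero p])
  qed
qed simp

lemma solution_growth_generic:
  "\<exists>C\<ge>1. \<forall>z. \<forall>R>0. (\<forall>p\<in>cball z R. \<not> is_pole u p) \<longrightarrow> norm (u z) \<le> C * max 1 (1 / R)"
proof (rule solution_growth[OF sol coeffs_nonzero])
  fix C :: real
  assume "C \<ge> 1" "\<And>z R. R > 0 \<Longrightarrow> (\<And>p. p \<in> cball z R \<Longrightarrow> \<not> is_pole u p) \<Longrightarrow>
    norm (u z) \<le> C * max 1 (1 / R)"
  then show ?thesis by blast
qed

end

lemma solution_finite_poles_rational:
  assumes sol: "meromorphic_solution n a b \<alpha> u" and gen: "generic_coeffs n a"
    and fin: "finite {p. is_pole u p}"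
  shows "rational_fun u"
proof -
  note nice = meromorphic_solution_nicely[OF sol]
  obtain C where C: "C \<ge> 1"
    "\<And>z R. R > 0 \<Longrightarrow> (\<And>p. p \<in> cball z R \<Longrightarrow> \<not> is_pole u p) \<Longrightarrow> norm (u z) \<le> C * max 1 (1 / R)"
    using solution_growth_generic[OF sol gen] by blast
  obtain r where r: "\<And>p. is_pole u p \<Longrightarrow> norm p \<le> r"
    using finite_imp_bounded[OF fin] unfolding bounded_iff by auto
  \<comment> \<open>With the identity as factor map the periodicity condition is trivial. Beyond
    radius r + 2 all poles are more than 1 away, so the growth bound with R = 1 gives |u| \<le>
    C.\<close>
  obtain R where "rational_fun R" "\<And>z. u z = R z"
  proof (rule rational_of_factor[OF nice, of "\<lambda>z. z" "{p. is_pole u p}" "cball 0 (r + 2)" 1 C])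
    show "(\<exists>z'\<in>cball 0 (r + 2). z' = z) \<or>
        norm (u z) \<le> C \<and> \<not> is_pole u z \<and> (\<forall>p\<in>{p. is_pole u p}. 1 \<le> norm (z - p))" for z
    proof (cases "norm z \<le> r + 2")
      case False
      then have far: "norm (z - p) \<ge> 1 \<and> p \<notin> cball z 1" if "is_pole u p" for p
        using r[OF that] norm_triangle_ineq2[of z p] by (simp add: dist_norm)
      then have "norm (u z) \<le> C * max 1 (1 / 1)" by (intro C(2)) auto
      moreover have "\<not> is_pole u z" using far[of z] by auto
      ultimately show ?thesis using far by auto
    qed simp
    show "(\<lambda>z. z) holomorphic_on UNIV" by (intro holomorphic_intros)
    show "\<exists>\<rho> U. \<rho> > 0 \<and> U holomorphic_on ball p \<rho> \<and> (\<forall>z\<in>ball p \<rho> - {p}. u z = U z * (z - p) powi (-1))"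
      if "is_pole u p" for p
      by (rule solution_simple_pole[OF sol gen that])
  qed (use fin in \<open>auto intro: that\<close>)
  then have "u = R" by auto
  then show ?thesis using \<open>rational_fun R\<close> by simp
qed

text \<open>Already the moduli differ by this much. The gap is exp (\<beta> + 1) - exp \<beta> to
  the right of the strip and exp (- \<beta>) - exp (- \<beta> - 1) to the left; the left one is the
  smaller, as \<beta> \<ge> 0.\<close>

lemma norm_exp_diff_ge:
  assumes "\<bar>Re w\<bar> \<le> \<beta>" "\<bar>Re z\<bar> \<ge> \<beta> + 1"
  shows "norm (exp z - exp w) \<ge> exp (- \<beta>) - exp (- \<beta> - 1)"
proof -
  have conv: "exp (- \<beta>) - exp (- \<beta> - 1) \<le> exp (\<beta> + 1) - exp \<beta>" if "\<beta> \<ge> 0"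
  proof -
    have "exp (- \<beta>) - exp (- \<beta> - 1) = exp (- \<beta>) * (1 - exp (-1))"
      by (simp add: algebra_simps flip: exp_add)
    also have "\<dots> \<le> exp \<beta> * (exp 1 - 1)"
    proof (rule mult_mono)
      show "1 - exp (-1) \<le> exp 1 - (1 :: real)"
        using exp_ge_add_one_self[of 1] exp_gt_zero[of "-1 :: real"] by linarith
    qed (use that in auto)
    also have "\<dots> = exp (\<beta> + 1) - exp \<beta>" by (simp add: algebra_simps exp_add)
    finally show ?thesis .
  qed
  have \<beta>: "\<beta> \<ge> 0" using assms(1) by linarith
  consider "Re z \<ge> \<beta> + 1" | "Re z \<le> - \<beta> - 1" using assms(2) by linarith
  then show ?thesis
  proof cases
    case 1
    have "exp (\<beta> + 1) \<le> exp (Re z)" "exp (Re w) \<le> exp \<beta>" using 1 assms(1) by auto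
    then have "exp (\<beta> + 1) - exp \<beta> \<le> norm (exp z) - norm (exp w)"
      unfolding norm_exp_eq_Re by linarith
    also have "\<dots> \<le> norm (exp z - exp w)" by (rule norm_triangle_ineq2)
    finally show ?thesis using conv[OF \<beta>] by linarith
  next
    case 2
    have "exp (Re z) \<le> exp (- \<beta> - 1)" "exp (- \<beta>) \<le> exp (Re w)" using 2 assms(1) by auto
    then have "exp (- \<beta>) - exp (- \<beta> - 1) \<le> norm (exp w) - norm (exp z)"
      unfolding norm_exp_eq_Re by linarith
    also have "\<dots> \<le> norm (exp z - exp w)" by (metis norm_minus_commute norm_triangle_ineq2)
    finally show ?thesis .
  qed
qed

lemma periodic_multiple:
  fixes u :: "complex \<Rightarrow> complex"
  assumes "\<And>z. u (z + \<omega>) = u z"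
  shows "u (z + of_int m * \<omega>) = u z"
proof -
  interpret periodic_fun_simple u \<omega> by standard (rule assms)
  show ?thesis using plus_of_int[of z m] by simp
qed

text \<open>In the coordinate k z with k = 2 pi i / \<omega> the period becomes 2 pi i and the poles
  lie in a vertical strip. Modulo the period, a slightly wider strip is a compact rectangle, which
  holds representatives of all poles.\<close>

lemma solution_strip_rational_exp:
  assumes sol: "meromorphic_solution n a b \<alpha> u" and gen: "generic_coeffs n a"
    and \<omega>: "\<omega> \<noteq> 0" "\<And>z. u (z + \<omega>) = u z"
    and strip: "\<And>p. is_pole u p \<Longrightarrow> \<bar>Re (2 * pi * \<i> / \<omega> * p)\<bar> \<le> \<beta>"
  shows "rational_exp_fun u"
proof -
  note nice = meromorphic_solution_nicely[OF sol]
  obtain C where C: "C \<ge> 1"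
    "\<And>z R. R > 0 \<Longrightarrow> (\<And>p. p \<in> cball z R \<Longrightarrow> \<not> is_pole u p) \<Longrightarrow> norm (u z) \<le> C * max 1 (1 / R)"
    using solution_growth_generic[OF sol gen] by blast
  define k where "k = 2 * pi * \<i> / \<omega>"
  have k: "k \<noteq> 0" using \<omega>(1) by (simp add: k_def)
  have exp_eq: "exp (k * z) = exp (k * p) \<longleftrightarrow> (\<exists>m. z = p + of_int m * \<omega>)" for z p
  proof -
    have "k * z = k * p + of_int (2 * m) * pi * \<i> \<longleftrightarrow> z = p + of_int m * \<omega>" for m
    proof -
      have "of_int (2 * m) * pi * \<i> = k * (of_int m * \<omega>)" using \<omega>(1) by (simp add: k_def)
      then have "k * z = k * p + of_int (2 * m) * pi * \<i> \<longleftrightarrow> k * z = k * (p + of_int m * \<omega>)"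
        by (simp only: distrib_left)
      then show ?thesis using k by simp
    qed
    then show ?thesis unfolding exp_eq by simp
  qed
  have shift: "\<exists>z'. exp (k * z') = exp (k * z) \<and> Re (k * z') = Re (k * z) \<and>
      0 \<le> Im (k * z') \<and> Im (k * z') < 2 * pi \<and> (is_pole u z \<longrightarrow> is_pole u z')" for z
  proof -
    define m where "m = \<lfloor>Im (k * z) / (2 * pi)\<rfloor>"
    define z' where "z' = z + of_int (- m) * \<omega>"
    have kz': "k * z' = k * z - of_int m * (2 * pi * \<i>)"
      using \<omega>(1) by (simp add: z'_def k_def field_simps)
    have "of_int m \<le> Im (k * z) / (2 * pi)" "Im (k * z) / (2 * pi) < of_int m + 1"
      unfolding m_def by linarith+
    then have "0 \<le> Im (k * z')" "Im (k * z') < 2 * pi"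
      unfolding kz' by (auto simp: field_simps)
    moreover have "Re (k * z') = Re (k * z)" unfolding kz' by simp
    moreover have "exp (k * z') = exp (k * z)" unfolding exp_eq z'_def by blast
    moreover have "is_pole u z'" if "is_pole u z"
    proof -
      have "(\<lambda>w. u (w + of_int m * \<omega>)) = u" using periodic_multiple[of u \<omega>, OF \<omega>(2)] by auto
      then show ?thesis using that is_pole_shift_iff[of u "of_int m * \<omega>" z'] by (simp add: o_def add_ac z'_def)
    qed
    ultimately show ?thesis by blast
  qed
  define S where "S = {p. is_pole u p \<and> 0 \<le> Im (k * p) \<and> Im (k * p) < 2 * pi}"
  define box where "box = (\<lambda>\<zeta>. \<zeta> / k) ` cbox (Complex (- \<beta> - 1) 0) (Complex (\<beta> + 1) (2 * pi))"
  have box: "compact box" unfolding box_def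
    by (intro compact_continuous_image continuous_intros compact_cbox) (simp add: k)
  have in_box: "z \<in> box" if "\<bar>Re (k * z)\<bar> \<le> \<beta> + 1" "0 \<le> Im (k * z)" "Im (k * z) \<le> 2 * pi" for z
  proof -
    have "k * z \<in> cbox (Complex (- \<beta> - 1) 0) (Complex (\<beta> + 1) (2 * pi))"
      using that by (auto simp: in_cbox_complex_iff)
    moreover have "z = k * z / k" using k by simp
    ultimately show ?thesis unfolding box_def by blast
  qed
  have "S \<subseteq> box \<inter> {p. is_pole u p}"
    unfolding S_def using in_box strip by (force simp: k_def)
  then have finS: "finite S" using finite_poles_in_compact[OF nice box] finite_subset by blast
  define \<delta> where "\<delta> = exp (- \<beta>) - exp (- \<beta> - 1)"
  \<comment> \<open>Where |Re (k z)| exceeds \<beta> + 1, every pole is farther than 1 / |k| from z;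
    this is where \<open>norm k\<close> in the bound on u comes from.\<close>
  obtain R where R: "rational_fun R" "\<And>z. u z = R (exp (k * z))"
  proof (rule rational_of_factor[OF nice, of "\<lambda>z. exp (k * z)" S box \<delta> "C * max 1 (norm k)"])
    show "finite S" "compact box" by fact+
    show "\<delta> > 0" by (simp add: \<delta>_def)
    show "(\<lambda>z. exp (k * z)) holomorphic_on UNIV" by (intro holomorphic_intros)
    show "\<exists>\<rho> U. \<rho> > 0 \<and> U holomorphic_on ball p \<rho> \<and> (\<forall>z\<in>ball p \<rho> - {p}. u z = U z * (z - p) powi (-1))"
      if "is_pole u p" for p
      by (rule solution_simple_pole[OF sol gen that])
    show "is_pole u p \<and> deriv (\<lambda>z. exp (k * z)) p \<noteq> 0" if "p \<in> S" for p
    proof -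
      have "deriv (\<lambda>z. exp (k * z)) p = k * exp (k * p)"
        by (rule DERIV_imp_deriv) (auto intro!: derivative_eq_intros)
      then show ?thesis using that k by (simp add: S_def)
    qed
    show "inj_on (\<lambda>z. exp (k * z)) S"
    proof (rule inj_onI)
      fix x y assume xy: "x \<in> S" "y \<in> S" "exp (k * x) = exp (k * y)"
      have "k * x = k * y"
        by (rule exp_complex_eqI) (use xy in \<open>auto simp: S_def\<close>)
      then show "x = y" using k by simp
    qed
    show "\<exists>p\<in>S. exp (k * z) = exp (k * p)" if "is_pole u z" for z
      using shift[of z] that unfolding S_def by force
    show "u (w + (z - p)) = u w \<and> exp (k * (w + (z - p))) = exp (k * w)"
      if eq: "exp (k * z) = exp (k * p)" for z p w
    proof -
      obtain m where "z = p + of_int m * \<omega>" using eq unfolding exp_eq by blast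
      then have "w + (z - p) = w + of_int m * \<omega>" by simp
      then show ?thesis using periodic_multiple[of u \<omega>, OF \<omega>(2)] exp_eq by metis
    qed
    show "(\<exists>z'\<in>box. exp (k * z') = exp (k * z)) \<or> norm (u z) \<le> C * max 1 (norm k) \<and>
        \<not> is_pole u z \<and> (\<forall>p\<in>S. \<delta> \<le> norm (exp (k * z) - exp (k * p)))" for z
    proof (cases "\<bar>Re (k * z)\<bar> \<le> \<beta> + 1")
      case True
      obtain z' where z': "exp (k * z') = exp (k * z)" "Re (k * z') = Re (k * z)"
        "0 \<le> Im (k * z')" "Im (k * z') < 2 * pi" using shift[of z] by blast
      have "z' \<in> box" by (rule in_box) (use z' True in linarith)+
      then show ?thesis using z'(1) by blast
    next
      case False
      then have far: "\<bar>Re (k * z)\<bar> \<ge> \<beta> + 1" "\<bar>Re (k * z)\<bar> > \<beta> + 1" by auto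
      have "p \<notin> cball z (1 / norm k)" if "is_pole u p" for p
      proof
        assume "p \<in> cball z (1 / norm k)"
        then have "norm (k * z - k * p) \<le> 1"
        proof -
          have "norm (k * z - k * p) = norm k * norm (z - p)"
            by (simp only: norm_mult flip: right_diff_distrib)
          also have "\<dots> \<le> norm k * (1 / norm k)"
            using \<open>p \<in> cball z (1 / norm k)\<close> by (intro mult_left_mono) (auto simp: dist_norm)
          finally show ?thesis using k by simp
        qed
        then have "\<bar>Re (k * z) - Re (k * p)\<bar> \<le> 1"
          using abs_Re_le_cmod[of "k * z - k * p"] by simp
        then show False using strip[OF that] far(2) unfolding k_def[symmetric] by linarith
      qed
      then have "norm (u z) \<le> C * max 1 (1 / (1 / norm k))"
        using k by (intro C(2)) auto
      moreover have "\<not> is_pole u z"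
        using strip[of z] far(2) unfolding k_def[symmetric] by linarith
      moreover have "\<delta> \<le> norm (exp (k * z) - exp (k * p))" if "p \<in> S" for p
        unfolding \<delta>_def using strip[of p] that far(1)
        by (intro norm_exp_diff_ge) (auto simp: S_def k_def)
      ultimately show ?thesis by simp
    qed
  qed (rule that)
  then show ?thesis unfolding rational_exp_fun_def by blast
qed

lemma solution_in_class_W:
  assumes sol: "meromorphic_solution n a b \<alpha> u" and gen: "generic_coeffs n a"
  shows "u \<in> class_W"
proof (cases "finite {p. is_pole u p}")
  case True
  then show ?thesis using solution_finite_poles_rational[OF sol gen] by (simp add: class_W_def)
next
  case False
  let ?P = "{p. is_pole u p}"
  from pigeonhole_infinite[OF False solution_finite_residues[OF sol gen]] obtain p0 where
    p0: "is_pole u p0" "infinite {p \<in> ?P. residue u p = residue u p0}" by auto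
  then have "infinite ({p \<in> ?P. residue u p = residue u p0} - {p0})" by simp
  then have "{p \<in> ?P. residue u p = residue u p0} - {p0} \<noteq> {}" by (metis finite.emptyI)
  then obtain p1 where p1: "is_pole u p1" "residue u p1 = residue u p0" "p1 \<noteq> p0" by blast
  define \<omega> where "\<omega> = p1 - p0"
  have \<omega>: "\<omega> \<noteq> 0" "\<And>z. u (z + \<omega>) = u z"
    using p1(3) solution_period[OF gen sol p0(1) p1(1) p1(2)[symmetric]] by (auto simp: \<omega>_def)
  show ?thesis
  proof (cases "\<exists>\<omega>2. \<omega>2 / \<omega> \<notin> \<real> \<and> (\<forall>z. u (z + \<omega>2) = u z)")
    case True
    then have "elliptic u"
      unfolding elliptic_def using \<omega> meromorphic_solution_nicely[OF sol] by blast
    then show ?thesis by (simp add: class_W_def)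
  next
    case False
    let ?f = "\<lambda>p. Re (2 * pi * \<i> / \<omega> * p)"
    \<comment> \<open>The difference q - p is a period, hence a real multiple of \<omega>, and
      changes 2 pi i p / \<omega> by a purely imaginary amount. So \<open>?f\<close> takes one value
      per residue, hence finitely many, and the poles lie in a strip.\<close>
    have "?f p = ?f q" if "is_pole u p" "is_pole u q" "residue u p = residue u q" for p q
    proof -
      have "(q - p) / \<omega> \<in> \<real>"
        using False solution_period[OF gen sol that] by blast
      then obtain t where "(q - p) / \<omega> = of_real t" by (auto elim: Reals_cases)
      then have "2 * pi * \<i> / \<omega> * q - 2 * pi * \<i> / \<omega> * p = 2 * pi * \<i> * of_real t"
        using \<omega>(1) by (simp add: field_simps)
      then have "Re (2 * pi * \<i> / \<omega> * q - 2 * pi * \<i> / \<omega> * p) = 0" by simp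
      then show ?thesis by simp
    qed
    then have "?f ` ?P \<subseteq> (\<lambda>c. ?f (SOME p. is_pole u p \<and> residue u p = c)) ` (residue u ` ?P)"
    proof -
      assume *: "\<And>p q. is_pole u p \<Longrightarrow> is_pole u q \<Longrightarrow> residue u p = residue u q \<Longrightarrow> ?f p = ?f q"
      show ?thesis
      proof
        fix x assume "x \<in> ?f ` ?P"
        then obtain p where p: "is_pole u p" "x = ?f p" by blast
        let ?q = "SOME q. is_pole u q \<and> residue u q = residue u p"
        have "is_pole u ?q \<and> residue u ?q = residue u p" by (rule someI[of _ p]) (use p in simp)
        then have "x = ?f ?q" unfolding p(2) using *[OF p(1)] by metis
        then show "x \<in> (\<lambda>c. ?f (SOME p. is_pole u p \<and> residue u p = c)) ` (residue u ` ?P)"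
          using p(1) by blast
      qed
    qed
    then have "finite (?f ` ?P)"
      using solution_finite_residues[OF sol gen] by (meson finite_imageI finite_subset)
    then obtain \<beta> where "\<And>p. is_pole u p \<Longrightarrow> \<bar>?f p\<bar> \<le> \<beta>"
      using finite_imp_bounded[of "?f ` ?P"] unfolding bounded_iff by auto
    then have "rational_exp_fun u"
      by (rule solution_strip_rational_exp[OF sol gen \<omega>])
    then show ?thesis by (simp add: class_W_def)
  qed
qed

section \<open>The Nevanlinna characteristic\<close>

text \<open>If f is not integrable, its integral is 0 by convention, and I is nonnegative because f
  is. The bound thus applies directly to the integrals in the Nevanlinna characteristic;
  \<open>E\<close> admits singularities of the majorant.\<close>

lemma integral_le_dominating:
  fixes f g :: "real \<Rightarrow> real"
  assumes "(g has_integral I) {a..b}" "finite E" "\<And>x. x \<in> {a..b} - E \<Longrightarrow> f x \<le> g x" "\<And>x. 0 \<le> f x"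
  shows "integral {a..b} f \<le> I"
proof -
  have I: "((\<lambda>x. if x \<in> E then f x else g x) has_integral I) {a..b}"
    by (rule has_integral_spike_finite[OF assms(2) _ assms(1)]) auto
  show ?thesis
  proof (cases "f integrable_on {a..b}")
    case True
    from has_integral_le[OF integrable_integral[OF True] I] show ?thesis
      using assms(3) by auto
  next
    case False
    have "I \<ge> 0"
      by (rule has_integral_nonneg[OF I]) (use assms(3,4) in \<open>auto intro: order_trans\<close>)
    then show ?thesis using False by (simp add: not_integrable_integral)
  qed
qed

lemma log_plus_nonneg: "log_plus x \<ge> 0"
  by (simp add: log_plus_def)

lemma log_plus_mono: "0 < x \<Longrightarrow> x \<le> y \<Longrightarrow> log_plus x \<le> log_plus y"
  by (auto simp: log_plus_def max_def)

text \<open>Since ln (1 / x) = 2 ln (1 / sqrt x), the logarithmic singularity is traded for an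
  integrable power with an elementary antiderivative.\<close>

lemma log_plus_inverse_le:
  assumes "x > 0"
  shows "log_plus (1 / x) \<le> 2 / sqrt x"
proof -
  have "ln (1 / x) = 2 * ln (1 / sqrt x)"
    using assms by (simp add: ln_div ln_sqrt)
  also have "\<dots> \<le> 2 * (1 / sqrt x)"
    using assms ln_bound[of "1 / sqrt x"] by simp
  finally show ?thesis using assms by (simp add: log_plus_def)
qed

text \<open>A weak form of Jordan's inequality: |sin x - x| \<le> |x|^3 / 6, and |x| \<le> 2 leaves
  the factor 1 - 4 / 6.\<close>

lemma abs_sin_ge_third:
  assumes "\<bar>x\<bar> \<le> pi / 2"
  shows "\<bar>x\<bar> / 3 \<le> \<bar>sin x\<bar>"
proof -
  have "\<bar>sin x - (\<Sum>m<3. sin_coeff m * x ^ m)\<bar> \<le> inverse (fact 3) * \<bar>x\<bar> ^ 3"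
    by (rule Maclaurin_sin_bound)
  then have "\<bar>sin x - x\<bar> \<le> \<bar>x\<bar> ^ 3 / 6"
    by (simp add: sin_coeff_def numeral_3_eq_3 fact_numeral lessThan_Suc)
  moreover have "\<bar>x\<bar> ^ 3 \<le> 4 * \<bar>x\<bar>"
  proof -
    have "\<bar>x\<bar> \<le> 2" using assms pi_less_4 by linarith
    then have "\<bar>x\<bar> * \<bar>x\<bar> \<le> 2 * 2" by (intro mult_mono) auto
    then have "\<bar>x\<bar> * (\<bar>x\<bar> * \<bar>x\<bar>) \<le> \<bar>x\<bar> * 4" by (intro mult_left_mono) auto
    then show ?thesis by (simp add: power3_eq_cube mult_ac)
  qed
  ultimately show ?thesis by linarith
qed

text \<open>Here m is the integer nearest to y / pi, and |sin| is invariant under translation by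
  multiples of pi.\<close>

lemma abs_sin_ge_nearest:
  assumes "\<bar>y\<bar> \<le> 2 * pi"
  obtains m where "m \<in> {-2..2 :: int}" "\<bar>y - of_int m * pi\<bar> / 3 \<le> \<bar>sin y\<bar>"
proof
  define m where "m = round (y / pi)"
  have near: "\<bar>y / pi - of_int m\<bar> \<le> 1 / 2"
    unfolding m_def using of_int_round_abs_le[of "y / pi"] by (simp add: abs_minus_commute)
  have "\<bar>y / pi\<bar> \<le> 2" using assms by (simp add: field_simps)
  with near have "\<bar>of_int m :: real\<bar> < 3" by linarith
  then show "m \<in> {-2..2}" by auto
  have "y - of_int m * pi = (y / pi - of_int m) * pi" by (simp add: field_simps)
  then have "\<bar>y - of_int m * pi\<bar> = \<bar>y / pi - of_int m\<bar> * pi" by (simp add: abs_mult)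
  also have "\<dots> \<le> 1 / 2 * pi" using near by (intro mult_right_mono) auto
  finally have "\<bar>y - of_int m * pi\<bar> / 3 \<le> \<bar>sin (y - of_int m * pi)\<bar>"
    by (intro abs_sin_ge_third) simp
  also have "\<bar>sin (y - of_int m * pi)\<bar> = \<bar>sin y\<bar>"
  proof -
    define x where "x = of_int m * pi"
    have sin: "sin x = 0" using sin_zero_iff_int2 unfolding x_def by blast
    then have "(cos x)\<^sup>2 = 1" using sin_cos_squared_add[of x] by simp
    then have "\<bar>cos x\<bar> = 1" by (simp add: abs_square_eq_1)
    then show ?thesis using sin unfolding x_def[symmetric] by (simp add: sin_diff abs_mult)
  qed
  finally show "\<bar>y - of_int m * pi\<bar> / 3 \<le> \<bar>sin y\<bar>" .
qed

text \<open>Isabelle's \<open>sqrt\<close> is an odd function, so \<open>2 * sqrt (t - s)\<close> is an antiderivative of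
  \<open>1 / sqrt \<bar>t - s\<bar>\<close> on both sides of \<open>s\<close>.\<close>

lemma has_integral_inverse_sqrt_abs:
  fixes a b s :: real
  assumes "a \<le> b"
  shows "((\<lambda>t. 1 / sqrt \<bar>t - s\<bar>) has_integral 2 * sqrt (b - s) - 2 * sqrt (a - s)) {a..b}"
proof (rule fundamental_theorem_of_calculus_strong[of "{s}"])
  show "((\<lambda>t. 2 * sqrt (t - s)) has_vector_derivative 1 / sqrt \<bar>x - s\<bar>) (at x)"
    if x: "x \<in> {a..b} - {s}" for x
  proof -
    have "DERIV sqrt (x - s) :> inverse (sqrt \<bar>x - s\<bar>) / 2"
      by (rule DERIV_real_sqrt_generic) (use x real_sqrt_minus[of "x - s"] in auto)
    moreover have "((\<lambda>t. t - s) has_real_derivative 1) (at x)"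
      by (auto intro!: derivative_eq_intros)
    ultimately have "(sqrt \<circ> (\<lambda>t. t - s) has_real_derivative inverse (sqrt \<bar>x - s\<bar>) / 2 * 1) (at x)"
      by (intro DERIV_chain)
    from DERIV_cmult[OF this, of 2]
    have "((\<lambda>t. 2 * sqrt (t - s)) has_real_derivative 2 * (inverse (sqrt \<bar>x - s\<bar>) / 2 * 1)) (at x)"
      by (simp only: o_def)
    moreover have "2 * (inverse (sqrt \<bar>x - s\<bar>) / 2 * 1) = 1 / sqrt \<bar>x - s\<bar>"
      by (simp only: inverse_eq_divide) simp
    ultimately show ?thesis by (simp only: has_real_derivative_iff_has_vector_derivative)
  qed
  show "continuous_on {a..b} (\<lambda>t. 2 * sqrt (t - s))" by (intro continuous_intros)
qed (use assms in auto)

text \<open>Rotate p to the nonnegative real axis and keep only the imaginary part.\<close>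

lemma norm_circle_minus_ge:
  assumes "r \<ge> 0"
  shows "r * \<bar>sin (\<theta> - Arg2pi p)\<bar> \<le> norm (of_real r * cis \<theta> - p)"
proof -
  let ?\<phi> = "Arg2pi p"
  have p: "p = of_real (norm p) * cis ?\<phi>"
    using Arg2pi_eq[of p] by (simp add: cis_conv_exp mult_ac)
  have "of_real r * cis \<theta> - p = cis ?\<phi> * (of_real r * cis (\<theta> - ?\<phi>) - of_real (norm p))"
    by (subst p) (simp add: cis_divide[symmetric] algebra_simps)
  then have "norm (of_real r * cis \<theta> - p) = norm (of_real r * cis (\<theta> - ?\<phi>) - of_real (norm p))"
    by (simp add: norm_mult)
  also have "\<dots> \<ge> \<bar>Im (of_real r * cis (\<theta> - ?\<phi>) - of_real (norm p))\<bar>"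
    by (rule abs_Im_le_cmod)
  finally show ?thesis using assms by (simp add: abs_mult)
qed

text \<open>The point is that \<open>J\<close> depends on t0 alone. For r \<le> t0 / 2 the circle
  stays away from p; for larger r the distance to p is at least t0 / 6 times the distance of
  \<theta> to a zero of the shifted sine.\<close>

lemma log_plus_circle_dominated:
  assumes t0: "t0 > 0"
  obtains J where "J \<ge> 0"
    "\<And>r p. r \<ge> 0 \<Longrightarrow> t0 \<le> norm p \<Longrightarrow> \<exists>g I E. (g has_integral I) {0..2 * pi} \<and> I \<le> J \<and> finite E \<and>
       (\<forall>\<theta>\<in>{0..2 * pi} - E. log_plus (1 / norm (of_real r * cis \<theta> - p)) \<le> g \<theta>)"
proof -
  \<comment> \<open>\<open>c\<close> arises from \<open>log_plus_inverse_le\<close> at distance t0 /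
    6 times the angle. The 80 in \<open>J\<close> is 5 * 16: five candidate zeros m in {-2..2}, each
    with an integral of at most 2 * 4 + 2 * 4.\<close>
  define c where "c = 2 / sqrt (t0 / 6)"
  have c: "c > 0" using t0 by (simp add: c_def)
  define J where "J = max (log_plus (2 / t0) * (2 * pi)) (c * 80)"
  show ?thesis
  proof (rule that[of J])
    show "J \<ge> 0" using c by (simp add: J_def max_def)
    fix r :: real and p :: complex
    assume r: "r \<ge> 0" and p: "t0 \<le> norm p"
    show "\<exists>g I E. (g has_integral I) {0..2 * pi} \<and> I \<le> J \<and> finite E \<and>
       (\<forall>\<theta>\<in>{0..2 * pi} - E. log_plus (1 / norm (of_real r * cis \<theta> - p)) \<le> g \<theta>)"
    proof (cases "r \<le> t0 / 2")
      case True
      show ?thesis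
      proof (intro exI conjI ballI)
        show "((\<lambda>_. log_plus (2 / t0)) has_integral (2 * pi - 0) *\<^sub>R log_plus (2 / t0)) {0..2 * pi}"
          using has_integral_const_real[of "log_plus (2 / t0)" 0 "2 * pi"] by simp
        show "(2 * pi - 0) *\<^sub>R log_plus (2 / t0) \<le> J" by (simp add: J_def mult_ac)
        show "finite {}" by simp
        fix \<theta> assume "\<theta> \<in> {0..2 * pi} - {}"
        have "norm p - r \<le> norm (of_real r * cis \<theta> - p)"
          using norm_triangle_ineq2[of p "of_real r * cis \<theta>"] r
          by (simp add: norm_mult norm_minus_commute)
        then have "t0 / 2 \<le> norm (of_real r * cis \<theta> - p)" using p True by linarith
        moreover from this have pos: "0 < norm (of_real r * cis \<theta> - p)" using t0 by linarith
        ultimately have "1 / norm (of_real r * cis \<theta> - p) \<le> 1 / (t0 / 2)"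
          using t0 by (intro divide_left_mono mult_pos_pos) auto
        then show "log_plus (1 / norm (of_real r * cis \<theta> - p)) \<le> log_plus (2 / t0)"
          using pos by (intro log_plus_mono) auto
      qed
    next
      case False
      define \<phi> where "\<phi> = Arg2pi p"
      have \<phi>: "0 \<le> \<phi>" "\<phi> < 2 * pi" by (simp_all add: \<phi>_def Arg2pi_ge_0 Arg2pi_lt_2pi)
      define s where "s m = \<phi> + of_int m * pi" for m :: int
      define G where "G m = 2 * sqrt (2 * pi - s m) - 2 * sqrt (0 - s m)" for m
      show ?thesis
      proof (intro exI conjI ballI)
        show "((\<lambda>\<theta>. c * (\<Sum>m\<in>{-2..2}. 1 / sqrt \<bar>\<theta> - s m\<bar>)) has_integral c * (\<Sum>m\<in>{-2..2}. G m)) {0..2 * pi}"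
          unfolding G_def
          by (intro has_integral_mult_right has_integral_sum has_integral_inverse_sqrt_abs) auto
        show "finite (s ` {-2..2})" by simp
        have "G m \<le> 16" if m: "m \<in> {-2..2}" for m
        proof -
          have "-2 \<le> real_of_int m" "real_of_int m \<le> 2" using m by auto
          then have "-2 * pi \<le> of_int m * pi" "of_int m * pi \<le> 2 * pi"
            by (intro mult_right_mono; simp)+
          then have "\<bar>2 * pi - s m\<bar> \<le> 16" "\<bar>s m\<bar> \<le> 16"
            using \<phi> pi_less_4 unfolding s_def by linarith+
          then have "sqrt (2 * pi - s m) \<le> sqrt 16" "sqrt (s m) \<le> sqrt 16"
            by (intro real_sqrt_le_mono; linarith)+
          moreover have "sqrt 16 = (4 :: real)" by (rule real_sqrt_unique) auto
          ultimately show ?thesis unfolding G_def by (simp add: real_sqrt_minus)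
        qed
        then have "(\<Sum>m\<in>{-2..2}. G m) \<le> of_nat (card {-2..2 :: int}) * 16"
          by (rule sum_bounded_above)
        then have "c * (\<Sum>m\<in>{-2..2}. G m) \<le> c * 80" using c by simp
        then show "c * (\<Sum>m\<in>{-2..2}. G m) \<le> J" by (simp add: J_def)
        fix \<theta> assume \<theta>: "\<theta> \<in> {0..2 * pi} - s ` {-2..2}"
        then have "\<bar>\<theta> - \<phi>\<bar> \<le> 2 * pi" using \<phi> by auto
        then obtain m where m: "m \<in> {-2..2}" "\<bar>\<theta> - \<phi> - of_int m * pi\<bar> / 3 \<le> \<bar>sin (\<theta> - \<phi>)\<bar>"
          using abs_sin_ge_nearest by blast
        define x where "x = \<bar>\<theta> - s m\<bar>"
        have x: "x > 0" "x / 3 \<le> \<bar>sin (\<theta> - \<phi>)\<bar>" using \<theta> m by (auto simp: x_def s_def algebra_simps)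
        let ?d = "norm (of_real r * cis \<theta> - p)"
        have "t0 / 2 * (x / 3) \<le> r * \<bar>sin (\<theta> - \<phi>)\<bar>"
          using False t0 x by (intro mult_mono) auto
        also have "\<dots> \<le> ?d" unfolding \<phi>_def by (rule norm_circle_minus_ge[OF r])
        finally have d: "t0 / 6 * x \<le> ?d" by simp
        have pos: "0 < t0 / 6 * x" using t0 x by simp
        have "log_plus (1 / ?d) \<le> 2 / sqrt ?d" by (rule log_plus_inverse_le) (use d pos in linarith)
        also have "\<dots> \<le> 2 / sqrt (t0 / 6 * x)"
          using d pos by (intro divide_left_mono real_sqrt_le_mono mult_pos_pos) auto
        also have "\<dots> = c * (1 / sqrt x)" unfolding c_def real_sqrt_mult by simp
        also have "\<dots> \<le> c * (\<Sum>m\<in>{-2..2}. 1 / sqrt \<bar>\<theta> - s m\<bar>)"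
        proof (rule mult_left_mono)
          show "1 / sqrt x \<le> (\<Sum>m\<in>{-2..2}. 1 / sqrt \<bar>\<theta> - s m\<bar>)"
            unfolding x_def by (rule member_le_sum[of m "{-2..2}" "\<lambda>m. 1 / sqrt \<bar>\<theta> - s m\<bar>"]) (use m in auto)
        qed (use c in simp)
        finally show "log_plus (1 / ?d) \<le> c * (\<Sum>m\<in>{-2..2}. 1 / sqrt \<bar>\<theta> - s m\<bar>)" .
      qed
    qed
  qed
qed

section \<open>Counting separated poles\<close>

lemma card_separated_le:
  fixes X :: "complex set"
  assumes \<delta>: "\<delta> > 0" and r: "r \<ge> 0" and X: "X \<subseteq> cball 0 r"
    and sep: "\<And>x y. x \<in> X \<Longrightarrow> y \<in> X \<Longrightarrow> x \<noteq> y \<Longrightarrow> \<delta> \<le> norm (x - y)"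
  shows "real (card X) \<le> 4 * (2 / \<delta> + 1)\<^sup>2 * (1 + r)\<^sup>2"
proof -
  define t where "t = 2 * r / \<delta>"
  have t: "t \<ge> 0" using \<delta> r by (simp add: t_def)
  \<comment> \<open>Squares of side \<delta> / 2: two points in the same square differ by less than
    \<delta> / 2 in each coordinate, hence by less than \<delta>, so each square holds at most one
    point.\<close>
  define f where "f z = (\<lfloor>2 * Re z / \<delta>\<rfloor>, \<lfloor>2 * Im z / \<delta>\<rfloor>)" for z
  let ?I = "{\<lfloor>- t\<rfloor>..\<lfloor>t\<rfloor>}"
  have cell: "\<bar>a - b\<bar> < \<delta> / 2" if "\<lfloor>2 * a / \<delta>\<rfloor> = \<lfloor>2 * b / \<delta>\<rfloor>" for a b
  proof -
    have "\<bar>2 * a / \<delta> - 2 * b / \<delta>\<bar> < 1" using that by linarith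
    then have "\<bar>2 * (a - b) / \<delta>\<bar> < 1" by (simp add: right_diff_distrib diff_divide_distrib)
    then have "\<bar>2 * (a - b)\<bar> < \<delta>" using \<delta> by (simp add: abs_divide)
    then show ?thesis by (simp only: abs_mult abs_numeral) simp
  qed
  have inj: "inj_on f X"
  proof (rule inj_onI, rule ccontr)
    fix x y assume xy: "x \<in> X" "y \<in> X" "f x = f y" "x \<noteq> y"
    have "norm (x - y) \<le> \<bar>Re (x - y)\<bar> + \<bar>Im (x - y)\<bar>" by (rule cmod_le)
    also have "\<dots> < \<delta>" using cell[of "Re x" "Re y"] cell[of "Im x" "Im y"] xy(3) by (simp add: f_def)
    finally show False using sep[OF xy(1,2,4)] by simp
  qed
  have "f ` X \<subseteq> ?I \<times> ?I"
  proof
    fix w assume "w \<in> f ` X"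
    then obtain z where z: "z \<in> X" "w = f z" by blast
    then have "norm z \<le> r" using X by auto
    then have "\<bar>Re z\<bar> \<le> r" "\<bar>Im z\<bar> \<le> r" using abs_Re_le_cmod abs_Im_le_cmod order_trans by blast+
    then have "- t \<le> 2 * Re z / \<delta>" "2 * Re z / \<delta> \<le> t" "- t \<le> 2 * Im z / \<delta>" "2 * Im z / \<delta> \<le> t"
      using \<delta> by (auto simp: t_def field_simps)
    then show "w \<in> ?I \<times> ?I" unfolding z(2) f_def by (simp add: floor_mono)
  qed
  then have "card X \<le> card (?I \<times> ?I)"
    using card_image[OF inj] card_mono[of "?I \<times> ?I" "f ` X"] by simp
  also have "real (card (?I \<times> ?I)) = real (card ?I) * real (card ?I)" by (simp add: card_cartesian_product)
  also have "\<dots> \<le> (2 * (t + 1)) * (2 * (t + 1))"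
  proof -
    have "real (card ?I) \<le> 2 * (t + 1)" using t by simp linarith
    then show ?thesis by (intro mult_mono) (use t in auto)
  qed
  also have "\<dots> = 4 * (t + 1)\<^sup>2" by (simp add: power2_eq_square algebra_simps)
  also have "\<dots> \<le> 4 * ((2 / \<delta> + 1) * (1 + r))\<^sup>2"
  proof -
    have "(2 / \<delta> + 1) * (1 + r) = t + 1 + (2 / \<delta> + r)"
      by (simp add: t_def algebra_simps add_divide_distrib)
    then have "t + 1 \<le> (2 / \<delta> + 1) * (1 + r)" using \<delta> r by simp
    then show ?thesis using t by (intro mult_left_mono power_mono) auto
  qed
  finally show ?thesis by (simp add: power_mult_distrib)
qed

text \<open>The difference of two such poles is a period and moves one fixed pole p0 to another
  pole. The isolation of p0 therefore bounds all these differences from below.\<close>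

lemma poles_separated:
  assumes gen: "generic_coeffs n a" and sol: "meromorphic_solution n a b \<alpha> u"
  obtains \<delta> where "\<delta> > 0"
    "\<And>p q. is_pole u p \<Longrightarrow> is_pole u q \<Longrightarrow> residue u p = residue u q \<Longrightarrow> p \<noteq> q \<Longrightarrow> \<delta> \<le> norm (p - q)"
proof (cases "\<exists>p. is_pole u p")
  case True
  then obtain p0 where p0: "is_pole u p0" by blast
  have "\<exists>\<delta>>0. \<forall>z. is_pole u z \<longrightarrow> z = p0 \<or> \<not> dist z p0 < \<delta>"
    using nicely_meromorphic_isolated_poles[OF meromorphic_solution_nicely[OF sol], of p0]
    unfolding islimpt_approachable by blast
  then obtain \<delta> where \<delta>: "\<delta> > 0" "\<And>z. is_pole u z \<Longrightarrow> z \<noteq> p0 \<Longrightarrow> \<delta> \<le> dist z p0"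
    by (meson not_less)
  show ?thesis
  proof (rule that[OF \<delta>(1)])
    fix p q assume pq: "is_pole u p" "is_pole u q" "residue u p = residue u q" "p \<noteq> q"
    have "(\<lambda>z. u (z + (p - q))) = u"
      using solution_period[OF gen sol pq(2,1) pq(3)[symmetric]] by auto
    then have "is_pole u (p0 + (p - q))"
      using p0 is_pole_shift_iff[of u "p - q" p0] by (simp add: o_def add_ac)
    from \<delta>(2)[OF this] pq(4) show "\<delta> \<le> norm (p - q)" by (simp add: dist_norm)
  qed
qed (use that[of 1] in auto)

text \<open>Separation is known only among poles with the same residue, so the finitely many
  residues are counted one by one.\<close>

lemma pole_count_quadratic:
  assumes gen: "generic_coeffs n a" and sol: "meromorphic_solution n a b \<alpha> u"
  obtains A where "A \<ge> 0"
    "\<And>r. r \<ge> 0 \<Longrightarrow> real (card {p. norm p \<le> r \<and> is_pole u p}) \<le> A * (1 + r)\<^sup>2"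
proof -
  obtain \<delta> where \<delta>: "\<delta> > 0"
    "\<And>p q. is_pole u p \<Longrightarrow> is_pole u q \<Longrightarrow> residue u p = residue u q \<Longrightarrow> p \<noteq> q \<Longrightarrow> \<delta> \<le> norm (p - q)"
    using poles_separated[OF gen sol] by blast
  define \<C> where "\<C> = residue u ` {p. is_pole u p}"
  have fin: "finite \<C>" unfolding \<C>_def by (rule solution_finite_residues[OF sol gen])
  show ?thesis
  proof (rule that[of "real (card \<C>) * (4 * (2 / \<delta> + 1)\<^sup>2)"])
    fix r :: real assume r: "r \<ge> 0"
    let ?X = "\<lambda>c. {p. norm p \<le> r \<and> is_pole u p \<and> residue u p = c}"
    have "card {p. norm p \<le> r \<and> is_pole u p} = card (\<Union>c\<in>\<C>. ?X c)"
      by (rule arg_cong[where f = card]) (auto simp: \<C>_def)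
    also have "\<dots> \<le> (\<Sum>c\<in>\<C>. card (?X c))" by (rule card_UN_le[OF fin])
    finally have "card {p. norm p \<le> r \<and> is_pole u p} \<le> (\<Sum>c\<in>\<C>. card (?X c))" .
    from of_nat_mono[OF this, where 'a = real]
    have "real (card {p. norm p \<le> r \<and> is_pole u p}) \<le> (\<Sum>c\<in>\<C>. real (card (?X c)))"
      by (simp only: of_nat_sum)
    also have "\<dots> \<le> (\<Sum>c\<in>\<C>. 4 * (2 / \<delta> + 1)\<^sup>2 * (1 + r)\<^sup>2)"
    proof (rule sum_mono, rule card_separated_le[OF \<delta>(1) r])
      fix c show "?X c \<subseteq> cball 0 r" by auto
      show "\<delta> \<le> norm (x - y)" if "x \<in> ?X c" "y \<in> ?X c" "x \<noteq> y" for x y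
        by (rule \<delta>(2)) (use that in simp_all)
    qed
    also have "\<dots> = real (card \<C>) * (4 * (2 / \<delta> + 1)\<^sup>2) * (1 + r)\<^sup>2" by simp
    finally show "real (card {p. norm p \<le> r \<and> is_pole u p}) \<le> \<dots>" .
  qed simp
qed

text \<open>Only the pole nearest to z matters. The sum over all poles of norm at most |z| + 1 is
  generous, but its index set depends on |z| alone and so stays fixed along a circle.\<close>

lemma solution_log_plus_le:
  assumes sol: "meromorphic_solution n a b \<alpha> u" and gen: "generic_coeffs n a"
  obtains L where "L \<ge> 0"
    "\<And>z. log_plus (norm (u z)) \<le> L +
       (\<Sum>p\<in>{p. norm p \<le> norm z + 1 \<and> is_pole u p}. log_plus (1 / norm (z - p)))"
proof -
  note nice = meromorphic_solution_nicely[OF sol]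
  obtain C where C: "C \<ge> 1"
    "\<And>z R. R > 0 \<Longrightarrow> (\<And>p. p \<in> cball z R \<Longrightarrow> \<not> is_pole u p) \<Longrightarrow> norm (u z) \<le> C * max 1 (1 / R)"
    using solution_growth_generic[OF sol gen] by blast
  show ?thesis
  proof (rule that[of "ln (2 * C)"])
    show "ln (2 * C) \<ge> 0" using C(1) by simp
    fix z :: complex
    let ?F = "{p. norm p \<le> norm z + 1 \<and> is_pole u p}"
    let ?S = "\<Sum>p\<in>?F. log_plus (1 / norm (z - p))"
    have S: "?S \<ge> 0" by (intro sum_nonneg log_plus_nonneg)
    have "?F = cball 0 (norm z + 1) \<inter> {p. is_pole u p}" by auto
    then have finF: "finite ?F" using finite_poles_in_compact[OF nice compact_cball] by simp
    show "log_plus (norm (u z)) \<le> ln (2 * C) + ?S"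
    proof (cases "is_pole u z")
      case True
      then show ?thesis
        using nicely_meromorphic_at_pole[OF nice] S C(1) by (simp add: log_plus_def)
    next
      case False
      show ?thesis
      proof (cases "\<exists>p. is_pole u p \<and> norm (z - p) < 1")
        case False
        have "norm (u z) \<le> C * max 1 (1 / (1 / 2))"
          by (rule C(2)) (use False in \<open>fastforce simp: dist_norm\<close>)+
        then have "norm (u z) \<le> 2 * C" by simp
        then have "ln (norm (u z)) \<le> ln (2 * C)"
          using C(1) by (cases "u z = 0") auto
        then show ?thesis using S C(1) by (simp add: log_plus_def)
      next
        case True
        let ?N = "cball z 1 \<inter> {p. is_pole u p}"
        have "finite ?N" by (rule finite_poles_in_compact[OF nice compact_cball])
        moreover have "?N \<noteq> {}"
        proof -
          obtain p where "is_pole u p" "norm (z - p) < 1" using True by blast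
          then have "p \<in> ?N" by (simp add: dist_norm)
          then show ?thesis by blast
        qed
        ultimately obtain q where q: "q \<in> ?N" "\<And>p. p \<in> ?N \<Longrightarrow> norm (z - q) \<le> norm (z - p)"
          using arg_min_if_finite[of ?N "\<lambda>p. norm (z - p)"] by (metis not_less)
        define d where "d = norm (z - q)"
        have "q \<noteq> z" using q(1) False by auto
        then have d: "d > 0" by (simp add: d_def)
        have d1: "d < 1"
        proof -
          obtain p where p: "is_pole u p" "norm (z - p) < 1" using True by blast
          then have "d \<le> norm (z - p)" unfolding d_def by (intro q(2)) (simp add: dist_norm)
          then show ?thesis using p(2) by simp
        qed
        \<comment> \<open>The nearest pole lies on the boundary of the disc of radius d, so the
          pole-free closed disc is taken with half that radius.\<close>
        have "norm (u z) \<le> C * max 1 (1 / (d / 2))"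
        proof (rule C(2))
          fix p assume p: "p \<in> cball z (d / 2)"
          show "\<not> is_pole u p"
          proof
            assume "is_pole u p"
            then have "d \<le> norm (z - p)"
              unfolding d_def by (intro q(2)) (use p d1 in \<open>simp add: dist_norm\<close>)
            then show False using p d by (simp add: dist_norm)
          qed
        qed (use d in simp)
        also have "max 1 (1 / (d / 2)) = 2 * (1 / d)" using d d1 by (simp add: field_simps max_def)
        finally have le: "norm (u z) \<le> (2 * C) * (1 / d)" by (simp only: mult_ac)
        have "log_plus (norm (u z)) \<le> ln (2 * C) + log_plus (1 / d)"
        proof (cases "u z = 0")
          case True
          then show ?thesis using C(1) log_plus_nonneg[of "1 / d"] by (simp add: log_plus_def)
        next
          case False
          then have "ln (norm (u z)) \<le> ln ((2 * C) * (1 / d))"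
            using le by (intro ln_mono) auto
          also have "\<dots> = ln (2 * C) + ln (1 / d)" using C(1) d by (subst ln_mult) auto
          finally show ?thesis using C(1) by (simp add: log_plus_def max_def)
        qed
        moreover have "log_plus (1 / d) \<le> ?S"
          unfolding d_def
        proof (rule member_le_sum[of q ?F "\<lambda>p. log_plus (1 / norm (z - p))"])
          have "norm q \<le> norm z + norm (z - q)"
            by (metis norm_minus_commute norm_triangle_sub)
          then show "q \<in> ?F" using q(1) by (simp add: dist_norm)
        qed (auto simp: log_plus_nonneg finF)
        ultimately show ?thesis by linarith
      qed
    qed
  qed
qed

text \<open>A pole at the origin is treated apart: its proximity term log+ (1 / r) is unbounded as r
  tends to 0 and is cancelled by the term n0 ln r of the counting function. All other poles have
  norm at least t0, which makes the estimates uniform.\<close>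

lemma solution_nevanlinna_bound:
  assumes sol: "meromorphic_solution n a b \<alpha> u" and gen: "generic_coeffs n a"
  obtains B where "B \<ge> 0" "\<And>r. r \<ge> 0 \<Longrightarrow> nevanlinna_T r u \<le> B * (1 + r) ^ 3"
proof -
  note nice = meromorphic_solution_nicely[OF sol]
  define P where "P r = {p. norm p \<le> r \<and> is_pole u p}" for r
  define n0 where "n0 = real (card (P 0))"
  obtain A where A: "A \<ge> 0" "\<And>r. r \<ge> 0 \<Longrightarrow> real (card (P r)) \<le> A * (1 + r)\<^sup>2"
    using pole_count_quadratic[OF gen sol] unfolding P_def by blast
  obtain L where L: "L \<ge> 0" "\<And>z. log_plus (norm (u z)) \<le> L + (\<Sum>p\<in>P (norm z + 1). log_plus (1 / norm (z - p)))"
    using solution_log_plus_le[OF sol gen] unfolding P_def by blast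
  have "\<exists>t0>0. \<forall>p. is_pole u p \<longrightarrow> p = 0 \<or> \<not> dist p 0 < t0"
    using nicely_meromorphic_isolated_poles[OF nice, of 0] unfolding islimpt_approachable by blast
  then obtain t0 where t0: "t0 > 0" "\<And>p. is_pole u p \<Longrightarrow> p \<noteq> 0 \<Longrightarrow> t0 \<le> norm p"
    by (auto simp: not_less)
  obtain J where J: "J \<ge> 0"
    "\<And>r p. r \<ge> 0 \<Longrightarrow> t0 \<le> norm p \<Longrightarrow> \<exists>g I E. (g has_integral I) {0..2 * pi} \<and> I \<le> J \<and> finite E \<and>
       (\<forall>\<theta>\<in>{0..2 * pi} - E. log_plus (1 / norm (of_real r * cis \<theta> - p)) \<le> g \<theta>)"
    using log_plus_circle_dominated[OF t0(1)] by blast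
  have finP: "finite (P r)" for r
  proof -
    have "P r = cball 0 r \<inter> {p. is_pole u p}" by (auto simp: P_def)
    then show ?thesis using finite_poles_in_compact[OF nice compact_cball] by simp
  qed
  have count: "pole_count r u = card (P r)" for r
  proof -
    have "pole_count r u = (\<Sum>z\<in>P r. 1)"
      unfolding pole_count_def P_def by (rule sum.cong) (auto simp: solution_zorder_pole[OF sol gen])
    then show ?thesis by simp
  qed
  have P0: "P 0 \<subseteq> {0}" by (auto simp: P_def)
  then have n0: "0 \<le> n0" "n0 \<le> 1"
    using card_mono[OF _ P0] by (auto simp: n0_def)
  have prox: "proximity r u \<le> L + n0 * log_plus (1 / r) + J * (A * (2 + r)\<^sup>2)" if r: "r \<ge> 0" for r
  proof -
    define Q where "Q = P (r + 1) - {0}"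
    have Q: "finite Q" "card Q \<le> card (P (r + 1))"
      unfolding Q_def using finP by (auto intro: card_mono)
    have "\<forall>p\<in>Q. \<exists>g I E. (g has_integral I) {0..2 * pi} \<and> I \<le> J \<and> finite E \<and>
       (\<forall>\<theta>\<in>{0..2 * pi} - E. log_plus (1 / norm (of_real r * cis \<theta> - p)) \<le> g \<theta>)"
      using J(2)[OF r] t0(2) by (auto simp: Q_def P_def)
    then obtain g I E where g: "\<And>p. p \<in> Q \<Longrightarrow> (g p has_integral I p) {0..2 * pi}"
      "\<And>p. p \<in> Q \<Longrightarrow> I p \<le> J" "\<And>p. p \<in> Q \<Longrightarrow> finite (E p)"
      "\<And>p \<theta>. p \<in> Q \<Longrightarrow> \<theta> \<in> {0..2 * pi} - E p \<Longrightarrow> log_plus (1 / norm (of_real r * cis \<theta> - p)) \<le> g p \<theta>"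
      by metis
    define K where "K = L + n0 * log_plus (1 / r)"
    have K: "K \<ge> 0" unfolding K_def using L(1) n0 log_plus_nonneg by simp
    \<comment> \<open>\<open>n0\<close> is 1 or 0 according to whether the origin is a pole.\<close>
    have split: "(\<Sum>p\<in>P (r + 1). f p) = n0 * f 0 + (\<Sum>p\<in>Q. f p)" for f :: "complex \<Rightarrow> real"
    proof (cases "is_pole u 0")
      case True
      then have "P 0 = {0}" "0 \<in> P (r + 1)" using r P0 by (auto simp: P_def)
      then show ?thesis using sum.remove[OF finP, of 0 "r + 1" f] by (simp add: n0_def Q_def)
    next
      case False
      then have "P 0 = {}" "Q = P (r + 1)" by (auto simp: P_def Q_def)
      then show ?thesis by (simp add: n0_def)
    qed
    have "integral {0..2 * pi} (\<lambda>\<theta>. log_plus (norm (u (of_real r * cis \<theta>)))) \<le> 2 * pi * K + (\<Sum>p\<in>Q. I p)"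
    proof (rule integral_le_dominating)
      have "((\<lambda>_. K) has_integral 2 * pi * K) {0..2 * pi}"
        using has_integral_const_real[of K 0 "2 * pi"] by simp
      then show "((\<lambda>\<theta>. K + (\<Sum>p\<in>Q. g p \<theta>)) has_integral 2 * pi * K + (\<Sum>p\<in>Q. I p)) {0..2 * pi}"
        by (intro has_integral_add has_integral_sum Q(1) g(1))
      show "finite (\<Union>p\<in>Q. E p)" using Q(1) g(3) by auto
      fix \<theta> assume \<theta>: "\<theta> \<in> {0..2 * pi} - (\<Union>p\<in>Q. E p)"
      have nr: "norm (of_real r * cis \<theta>) = r" using r by (simp add: norm_mult)
      have "log_plus (norm (u (of_real r * cis \<theta>))) \<le>
          L + (\<Sum>p\<in>P (r + 1). log_plus (1 / norm (of_real r * cis \<theta> - p)))"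
        using L(2)[of "of_real r * cis \<theta>"] unfolding nr .
      also have "\<dots> = K + (\<Sum>p\<in>Q. log_plus (1 / norm (of_real r * cis \<theta> - p)))"
        unfolding split K_def using nr by simp
      also have "\<dots> \<le> K + (\<Sum>p\<in>Q. g p \<theta>)"
        by (intro add_left_mono sum_mono g(4)) (use \<theta> in auto)
      finally show "log_plus (norm (u (of_real r * cis \<theta>))) \<le> K + (\<Sum>p\<in>Q. g p \<theta>)" .
    qed (rule log_plus_nonneg)
    also have "(\<Sum>p\<in>Q. I p) \<le> real (card Q) * J" by (rule sum_bounded_above) (rule g(2))
    also have "\<dots> \<le> A * (2 + r)\<^sup>2 * J"
      using Q(2) A(2)[of "r + 1"] r J(1) by (intro mult_right_mono) (auto simp: add_ac)
    also have "\<dots> \<le> 2 * pi * (J * (A * (2 + r)\<^sup>2))"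
    proof -
      have "1 * (J * (A * (2 + r)\<^sup>2)) \<le> 2 * pi * (J * (A * (2 + r)\<^sup>2))"
        using J(1) A(1) pi_ge_two by (intro mult_right_mono) auto
      then show ?thesis by (simp add: mult_ac)
    qed
    finally have "integral {0..2 * pi} (\<lambda>\<theta>. log_plus (norm (u (of_real r * cis \<theta>)))) \<le>
        2 * pi * (K + J * (A * (2 + r)\<^sup>2))" by (simp add: distrib_left)
    then have "1 / (2 * pi) * integral {0..2 * pi} (\<lambda>\<theta>. log_plus (norm (u (of_real r * cis \<theta>)))) \<le>
        1 / (2 * pi) * (2 * pi * (K + J * (A * (2 + r)\<^sup>2)))"
      by (intro mult_left_mono) auto
    then show ?thesis unfolding proximity_def K_def by simp
  qed
  have cnt: "counting r u \<le> r * (A * (1 + r)\<^sup>2 / t0) + n0 * ln r" if r: "r \<ge> 0" for r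
  proof -
    let ?D = "A * (1 + r)\<^sup>2 / t0"
    have "integral {0..r} (\<lambda>t. (real (pole_count t u) - real (pole_count 0 u)) / t) \<le> r * ?D"
    proof (rule integral_le_dominating)
      show "((\<lambda>_. ?D) has_integral r * ?D) {0..r}"
        using has_integral_const_real[of ?D 0 r] r by simp
      show "finite {}" by simp
      fix t :: real assume t: "t \<in> {0..r} - {}"
      show "(real (pole_count t u) - real (pole_count 0 u)) / t \<le> ?D"
      proof (cases "t < t0")
        case True
        \<comment> \<open>No pole other than the origin has norm below t0, so the integrand vanishes
          here.\<close>
        have "P t = P 0" using t True t0(2) by (fastforce simp: P_def)
        then show ?thesis using A(1) t0(1) by (simp add: count)
      next
        case False
        have "real (pole_count t u) - real (pole_count 0 u) \<le> A * (1 + t)\<^sup>2"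
          using A(2)[of t] t by (simp add: count)
        also have "\<dots> \<le> A * (1 + r)\<^sup>2"
          using t A(1) by (intro mult_left_mono power_mono) auto
        finally have "(real (pole_count t u) - real (pole_count 0 u)) / t \<le> A * (1 + r)\<^sup>2 / t"
          using False t0(1) by (intro divide_right_mono) auto
        also have "\<dots> \<le> ?D"
          using False t0(1) A(1) by (intro divide_left_mono) auto
        finally show ?thesis .
      qed
    next
      fix t :: real
      show "0 \<le> (real (pole_count t u) - real (pole_count 0 u)) / t"
      \<comment> \<open>\<open>integral_le_dominating\<close> asks for nonnegativity on the whole
        line. For negative t no pole is counted, and a nonpositive numerator is divided by a
        negative number.\<close>
      proof (cases "t < 0")
        case True
        then have "P t = {}" by (auto simp: P_def) (use norm_ge_zero order_trans not_less in blast)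
        then show ?thesis using True by (simp add: count divide_nonneg_neg)
      next
        case False
        then have "card (P 0) \<le> card (P t)" by (intro card_mono finP) (auto simp: P_def)
        then show ?thesis using False by (simp add: count)
      qed
    qed
    then show ?thesis unfolding counting_def by (simp add: count n0_def)
  qed
  show ?thesis
  \<comment> \<open>The 4 comes from 2 + r \<le> 2 (1 + r), A / t0 from the counting integral, and
    the final 1 from the logarithms belonging to the origin.\<close>
  proof (rule that[of "L + 4 * J * A + A / t0 + 1"])
    show "L + 4 * J * A + A / t0 + 1 \<ge> 0" using L(1) J(1) A(1) t0(1) by simp
    fix r :: real assume r: "r \<ge> 0"
    have cube: "1 \<le> (1 + r) ^ 3" "(1 + r)\<^sup>2 \<le> (1 + r) ^ 3" "r \<le> (1 + r) ^ 3"
      "r * (1 + r)\<^sup>2 \<le> (1 + r) ^ 3"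
    proof -
      show "1 \<le> (1 + r) ^ 3" using r by (simp add: one_le_power)
      show "(1 + r)\<^sup>2 \<le> (1 + r) ^ 3" using r by (intro power_increasing) auto
      show "r * (1 + r)\<^sup>2 \<le> (1 + r) ^ 3"
        using r mult_right_mono[of r "1 + r" "(1 + r)\<^sup>2"] by (simp add: power3_eq_cube power2_eq_square mult_ac)
      have "(1 + r) ^ 1 \<le> (1 + r) ^ 3" using r by (intro power_increasing) auto
      then show "r \<le> (1 + r) ^ 3" by simp
    qed
    \<comment> \<open>For 0 < r < 1 the logarithms cancel, and for r \<ge> 1 only ln r remains. At r
      = 0 both are 0 by the conventions for division and \<open>ln\<close>.\<close>
    have log: "n0 * (log_plus (1 / r) + ln r) \<le> r"
    proof -
      have "log_plus (1 / r) + ln r \<le> r"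
      proof (cases "r = 0")
        case False
        then show ?thesis using r ln_bound[of r] by (auto simp: log_plus_def ln_div max_def)
      qed (simp add: log_plus_def)
      moreover have "0 \<le> log_plus (1 / r) + ln r"
        using r by (cases "r = 0") (auto simp: log_plus_def ln_div)
      ultimately show ?thesis using n0 by (metis mult_left_le_one_le order_trans)
    qed
    have "(2 + r)\<^sup>2 \<le> (2 * (1 + r))\<^sup>2" using r by (intro power_mono) auto
    also have "\<dots> = 4 * (1 + r)\<^sup>2" by (simp only: power_mult_distrib) simp
    finally have "(2 + r)\<^sup>2 \<le> 4 * (1 + r) ^ 3" using cube(2) by linarith
    then have "J * (A * (2 + r)\<^sup>2) \<le> J * (A * (4 * (1 + r) ^ 3))"
      using J(1) A(1) by (intro mult_left_mono)
    moreover have "L * 1 \<le> L * (1 + r) ^ 3" using L(1) cube(1) by (intro mult_left_mono)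
    moreover have "A / t0 * (r * (1 + r)\<^sup>2) \<le> A / t0 * (1 + r) ^ 3"
      using cube(4) A(1) t0(1) by (intro mult_left_mono) auto
    moreover have "nevanlinna_T r u \<le> L + J * (A * (2 + r)\<^sup>2) + A / t0 * (r * (1 + r)\<^sup>2)
        + n0 * (log_plus (1 / r) + ln r)"
      using prox[OF r] cnt[OF r] unfolding nevanlinna_T_def by (simp add: algebra_simps)
    ultimately have "nevanlinna_T r u \<le>
        L * (1 + r) ^ 3 + J * (A * (4 * (1 + r) ^ 3)) + A / t0 * (1 + r) ^ 3 + (1 + r) ^ 3"
      using log cube(3) by linarith
    also have "\<dots> = (L + 4 * J * A + A / t0 + 1) * (1 + r) ^ 3" by (simp add: algebra_simps)
    finally show "nevanlinna_T r u \<le> \<dots>" .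
  qed
qed

section \<open>Hayman's bound from polynomial growth\<close>

lemma iter_exp_Suc_ge:
  assumes "x \<ge> 0"
  shows "exp x \<le> iter_exp (Suc l) x"
proof -
  have "y \<le> (exp ^^ l) y" for y :: real
  proof (induction l)
    case (Suc l)
    then show ?case using exp_ge_add_one_self[of "(exp ^^ l) y"] unfolding funpow.simps o_apply by linarith
  qed simp
  then show ?thesis unfolding iter_exp_def funpow_Suc_right by simp
qed

text \<open>For n \<ge> 2, (1 + r)^3 \<le> exp (3 r) gives b = 3 and c = 1. For n = 1 no exponential
  is available, and c = 3 takes up the cube. Passing from B to B + 1 makes the inequality
  strict.\<close>

lemma hayman_bound_of_cubic:
  assumes n: "n \<ge> 1" and B: "B \<ge> 0" "\<And>r. r \<ge> 0 \<Longrightarrow> nevanlinna_T r u \<le> B * (1 + r) ^ 3"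
    and R: "R > 0 \<or> (R = 0 \<and> n \<ge> 2)"
  shows "hayman_bound n u R"
proof (cases "n \<ge> 2")
  case True
  then obtain l where l: "n - 1 = Suc l" by (metis Suc_diff_Suc Suc_1 Suc_le_lessD diff_Suc_1 numeral_2_eq_2)
  show ?thesis unfolding hayman_bound_def l
  proof (intro exI conjI allI impI)
    show "B + 1 > 0" "(3 :: real) > 0" "(1 :: real) > 0" using B(1) by auto
    fix r assume "R \<le> r"
    then have r: "r \<ge> 0" using R by auto
    have "(1 + r) ^ 3 \<le> exp r ^ 3" using r by (intro power_mono) auto
    also have "\<dots> = exp (3 * r)" by (simp add: exp_of_nat_mult[symmetric])
    also have "\<dots> \<le> iter_exp (Suc l) (3 * r)" by (rule iter_exp_Suc_ge) (use r in simp)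
    finally have le: "(1 + r) ^ 3 \<le> iter_exp (Suc l) (3 * r)" .
    have "nevanlinna_T r u \<le> B * (1 + r) ^ 3" by (rule B(2)[OF r])
    also have "\<dots> < (B + 1) * (1 + r) ^ 3" using r by (simp add: distrib_right)
    also have "\<dots> \<le> (B + 1) * iter_exp (Suc l) (3 * r)" using B(1) le by (intro mult_left_mono) auto
    finally show "nevanlinna_T r u < (B + 1) * iter_exp (Suc l) (3 * r powr 1)" using r by simp
  qed
next
  case False
  then have n: "n - 1 = 0" and R: "R > 0" using n R by auto
  \<comment> \<open>For r \<ge> R one has 1 + r \<le> (1 + 1 / R) r, which turns the cube of 1 + r
    into a multiple of r^3.\<close>
  define a where "a = (B + 1) * (1 + 1 / R) ^ 3"
  show ?thesis unfolding hayman_bound_def n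
  proof (intro exI conjI allI impI)
    have "B + 1 > 0" "1 + 1 / R > 0" using B(1) R by (auto simp: add_pos_pos)
    then show "a > 0" unfolding a_def by (intro mult_pos_pos zero_less_power)
    show "(1 :: real) > 0" "(3 :: real) > 0" by auto
    fix r assume "R \<le> r"
    then have r: "r > 0" "1 \<le> r / R" using R by (auto simp: field_simps)
    have "(1 + r) ^ 3 \<le> ((1 + 1 / R) * r) ^ 3"
      using r by (intro power_mono) (auto simp: distrib_right)
    then have le: "(1 + r) ^ 3 \<le> (1 + 1 / R) ^ 3 * r ^ 3" by (simp only: power_mult_distrib)
    have "nevanlinna_T r u \<le> B * (1 + r) ^ 3" by (rule B(2)) (use r in simp)
    also have "\<dots> < (B + 1) * (1 + r) ^ 3" using r by (simp add: distrib_right)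
    also have "\<dots> \<le> (B + 1) * ((1 + 1 / R) ^ 3 * r ^ 3)" using B(1) le by (intro mult_left_mono) auto
    finally show "nevanlinna_T r u < a * iter_exp 0 (1 * r powr 3)"
      using r by (simp add: a_def iter_exp_def mult_ac)
  qed
qed

theorem theorem1p4:
  fixes n :: nat
  assumes "n \<ge> 1"
  shows "\<exists>S. S \<subseteq> cspace n \<and>
    (\<exists>\<H>. countable \<H> \<and> (\<forall>H\<in>\<H>. hypersurface n H) \<and> S = \<Union>\<H>) \<and>
    (\<forall>a\<in>cspace n - S. \<forall>b\<in>cspace n. \<forall>\<alpha> u.
       meromorphic_solution n a b \<alpha> u \<longrightarrow>
         u \<in> class_W \<and>
         (n \<ge> 2 \<longrightarrow> hayman_bound n u 0) \<and>
         (\<forall>R>0. hayman_bound n u R))"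
proof -
  let ?S = "{a \<in> cspace n. \<not> generic_coeffs n a}"
  have "u \<in> class_W \<and> (n \<ge> 2 \<longrightarrow> hayman_bound n u 0) \<and> (\<forall>R>0. hayman_bound n u R)"
    if "a \<in> cspace n - ?S" and sol: "meromorphic_solution n a b \<alpha> u" for a b \<alpha> u
  proof (intro conjI allI impI)
    have gen: "generic_coeffs n a" using that(1) by blast
    show "u \<in> class_W" by (rule solution_in_class_W[OF sol gen])
    obtain B where "B \<ge> 0" "\<And>r. r \<ge> 0 \<Longrightarrow> nevanlinna_T r u \<le> B * (1 + r) ^ 3"
      using solution_nevanlinna_bound[OF sol gen] by blast
    note bound = hayman_bound_of_cubic[OF assms this]
    show "hayman_bound n u 0" if "n \<ge> 2" by (rule bound) (use that in auto)
    show "hayman_bound n u R" if "R > 0" for R by (rule bound) (use that in auto)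
  qed
  then show ?thesis
    using nongeneric_coeffs_hypersurfaces[OF assms] by (intro exI[of _ ?S]) blast
qed

end
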